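(* Define the generating function $$W^{(\mathrm{cl})}(X,Y):=\frac{1}{X\,(X+Y)\,(Y-X)}+\sum_{n>k>0}\gamma_{n,k}\,X^{n-k-1}\,Y^{2k-2},$$ where for integers $0<k<n$ $$\gamma_{n,k}=\sum_{r=0}^{n-k-1}(-2)^{r+2}\binom{n-r+k-3}{2k-2}\,Z(k+n-r,r).$$ Then $$W^{(\mathrm{cl})}(X,Y)=\frac{V^{(\mathrm{cl})}(2X,-X-Y,Y-X)}{X\,(X+Y)\,(Y-X)}.$$
   Context: Multiple zeta values: $\zeta(k_1,\ldots,k_m)=\sum_{0<n_1<\cdots<n_m}n_1^{-k_1}\cdots n_m^{-k_m}$. For $k\ge2$, $r\ge0$, $$Z(k,r)=\sum_{\substack{j\ge0,\ (r_1,\dots,r_j)\in\{1,2\}^j\\ r_1+\cdots+r_j=r}}2^{\#\{i\,:\,r_i=1\}}\,\zeta(r_1,\dots,r_j,k).$$ For $s+t+u=0$, $$V^{(\mathrm{cl})}(s,t,u)=\frac{\Gamma(1+s)\,\Gamma(1+t)\,\Gamma(1+u)}{\Gamma(1-s)\,\Gamma(1-t)\,\Gamma(1-u)}.$$ The identity is one of generating series at the origin: the right-hand side minus $\frac{1}{X(X+Y)(Y-X)}$ is holomorphic near $(X,Y)=(0,0)$ and its Taylor series is the displayed double sum. *)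

theory Defs
  imports "HOL-Complex_Analysis.Complex_Analysis"
begin

text \<open>
  Multiple zeta values, with the summation order \<open>0 < n\<^sub>1 < \<dots> < n\<^sub>m\<close> (so the \<^emph>\<open>last\<close> argument governs
  convergence). All terms are nonnegative; \<^const>\<open>infsum\<close> is the usual sum when the last
  argument is at least 2, and a dummy value in the divergent case. The empty list gives 1.
\<close>

definition mzv :: "nat list \<Rightarrow> real" where
  "mzv ks = (\<Sum>\<^sub>\<infinity>ns \<in> {ns :: nat list. length ns = length ks \<and> sorted_wrt (<) ns \<and> (\<forall>n\<in>set ns. 0 < n)}.
     (\<Prod>i<length ks. 1 / real (ns ! i) ^ (ks ! i)))"

definition Z :: "nat \<Rightarrow> nat \<Rightarrow> real" where
  "Z k r = (\<Sum>rs | set rs \<subseteq> {1, 2} \<and> sum_list rs = r. 2 ^ count_list rs 1 * mzv (rs @ [k]))"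

text \<open>
  For \<open>0 < k < n\<close> and \<open>r \<le> n - k - 1\<close> none of the subtractions on natural numbers truncates.
\<close>

definition \<gamma> :: "nat \<Rightarrow> nat \<Rightarrow> real" where
  "\<gamma> n k = (\<Sum>r = 0..n - k - 1.
     (- 2) ^ (r + 2) * real ((n - r + k - 3) choose (2 * k - 2)) * Z (k + n - r) r)"

definition V_cl :: "complex \<Rightarrow> complex \<Rightarrow> complex \<Rightarrow> complex" where
  "V_cl s t u = (Gamma (1 + s) * Gamma (1 + t) * Gamma (1 + u)) /
                (Gamma (1 - s) * Gamma (1 - t) * Gamma (1 - u))"

definition W_idx :: "(nat \<times> nat) set" where
  "W_idx = {(n, k). 0 < k \<and> k < n}"

definition W_term :: "complex \<Rightarrow> complex \<Rightarrow> nat \<times> nat \<Rightarrow> complex" where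
  "W_term X Y = (\<lambda>(n, k). complex_of_real (\<gamma> n k) * X ^ (n - k - 1) * Y ^ (2 * k - 2))"

definition W_reg :: "complex \<Rightarrow> complex \<Rightarrow> complex" where
  "W_reg X Y = (\<Sum>\<^sub>\<infinity>p\<in>W_idx. W_term X Y p)"

definition W_cl :: "complex \<Rightarrow> complex \<Rightarrow> complex" where
  "W_cl X Y = 1 / (X * (X + Y) * (Y - X)) + W_reg X Y"

text \<open>
  Holomorphy in two complex variables (for open \<open>S\<close>): the real Frechet derivative exists and is
  complex linear.
\<close>

definition holomorphic2_on :: "(complex \<times> complex \<Rightarrow> complex) \<Rightarrow> (complex \<times> complex) set \<Rightarrow> bool" where
  "holomorphic2_on F S \<longleftrightarrow>
     (\<forall>p\<in>S. \<exists>a b. (F has_derivative (\<lambda>(h1, h2). a * h1 + b * h2)) (at p within S))"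

end

theory Submission
  imports Defs "HOL-Real_Asymp.Real_Asymp"
begin

text \<open>
  Since \<open>1 + 2y/n + y\<^sup>2/n\<^sup>2 = (1 + y/n)\<^sup>2\<close>, the generating function of \<open>Z k r\<close> in \<open>r\<close> is
  \<open>\<Sum>\<^sub>N N\<^bsup>-k\<^esup> \<Prod>\<^bsub>0<n<N\<^esub> (1 + y/n)\<^sup>2\<close>. Putting \<open>y = -2X\<close> and summing the binomial coefficients as the
  even part of a geometric series gives the regular part of \<open>W\<close> as
  \<open>\<Sum>\<^sub>N 4 N\<^bsup>-2\<^esup> \<Prod>\<^bsub>0<n<N\<^esub> (1 - 2X/n)\<^sup>2 (N - X) / ((N - X)\<^sup>2 - Y\<^sup>2)\<close>, and the polar term is the missing
  summand \<open>N = 0\<close>: up to the factor \<open>X (X + Y) (Y - X)\<close> this is a very-well-poised \<open>\<^sub>5F\<^sub>4\<close> series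
  with \<open>a = -2X\<close>, \<open>c = -X - Y\<close>, \<open>d = Y - X\<close>. Its first parameter can be shifted by 1 with a
  Wilf-Zeilberger pair, at the cost of an explicit rational factor. As the shift grows the series
  tends to 1 by dominated convergence, and the product of the factors tends to the quotient of
  Gamma values by Gauss's limit formula. Holomorphy follows from the Weierstrass M-test for
  the series over \<open>N\<close>, the partial derivatives being bounded by Cauchy's inequality.
\<close>

section \<open>A very-well-poised hypergeometric series\<close>

text \<open>
  The terms of a very-well-poised \<open>\<^sub>5F\<^sub>4\<close> series at 1 with parameters
  \<open>A, 1 + A/2, a, c, d\<close> over \<open>A/2, 1 + A - a, 1 + A - c, 1 + A - d\<close>, where \<open>A = a + M\<close> and \<open>a = c + d\<close>.
\<close>

definition vwp :: "complex \<Rightarrow> complex \<Rightarrow> complex \<Rightarrow> nat \<Rightarrow> nat \<Rightarrow> complex" where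
  "vwp a c d M N = (\<Prod>i<N. (a + of_nat M + of_nat i) * (a + of_nat i) * (c + of_nat i) * (d + of_nat i) /
     ((1 + of_nat i) * (1 + of_nat M + of_nat i) * (1 + of_nat M + c + of_nat i) * (1 + of_nat M + d + of_nat i)))"

text \<open>With \<open>A = a + M\<close>, the last factor is the quotient of the Pochhammer symbols
  of \<open>1 + A/2\<close> and \<open>A/2\<close>.\<close>

definition vwp_term :: "complex \<Rightarrow> complex \<Rightarrow> complex \<Rightarrow> nat \<Rightarrow> nat \<Rightarrow> complex" where
  "vwp_term a c d M N = vwp a c d M N * (1 + 2 * of_nat N / (a + of_nat M))"

text \<open>The factor relating the series at \<open>M\<close> and \<open>Suc M\<close>, see
  \<open>vwp_series_step\<close>. Its products over \<open>M\<close> are quotients of Pochhammer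
  symbols, with bases \<open>1 + a\<close>, \<open>1 - c\<close>, \<open>1 - d\<close> over
  \<open>1 + c\<close>, \<open>1 + d\<close>, \<open>1 - a\<close>.\<close>

definition vwp_ratio :: "complex \<Rightarrow> complex \<Rightarrow> complex \<Rightarrow> nat \<Rightarrow> complex" where
  "vwp_ratio a c d M = (1 + a + of_nat M) * (1 + of_nat M - c) * (1 + of_nat M - d) /
     ((1 + of_nat M + c) * (1 + of_nat M + d) * (1 + of_nat M - a))"

text \<open>
  The Wilf-Zeilberger companion for the shift of \<open>M\<close>, see \<open>wz_pair\<close> below. Gosper's ansatz with
  a linear polynomial factor determines it.
\<close>

definition vwp_cert :: "complex \<Rightarrow> complex \<Rightarrow> complex \<Rightarrow> nat \<Rightarrow> nat \<Rightarrow> complex" where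
  "vwp_cert a c d M N = - of_nat N * (of_nat N + 2 * of_nat M + 1) * vwp a c d M N /
     ((a + of_nat M) * (1 + of_nat M - a))"

lemma one_plus_nat_plus_nonzero:
  fixes z :: complex
  assumes "norm z < 1"
  shows "1 + of_nat n + z \<noteq> 0"
proof
  assume "1 + of_nat n + z = 0"
  then have "z = - of_nat (Suc n)" by (simp add: add_eq_0_iff2 algebra_simps)
  then have "norm z = real (Suc n)" by (metis norm_minus_cancel norm_of_nat)
  then show False using assms by simp
qed

lemma vwp_Suc:
  "vwp a c d M (Suc N) = vwp a c d M N * ((a + of_nat M + of_nat N) * (a + of_nat N) * (c + of_nat N) * (d + of_nat N) /
     ((1 + of_nat N) * (1 + of_nat M + of_nat N) * (1 + of_nat M + c + of_nat N) * (1 + of_nat M + d + of_nat N)))"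
  by (simp add: vwp_def)

text \<open>Since \<open>vwp_term\<close> divides by \<open>a\<close> at \<open>M = 0\<close>,
  \<open>a\<close> must not vanish. With the bound 1/20 the terms of \<open>vwp\<close> decay with
  exponent 19/20 + 18/20 + 18/20 = 11/4, uniformly in \<open>M\<close>; an exponent above 2 is what
  the certificate needs.\<close>

locale small_params =
  fixes a c d :: complex
  assumes na: "norm a \<le> 1/20" and nc: "norm c \<le> 1/20" and nd: "norm d \<le> 1/20"
    and a0: "a \<noteq> 0" and acd: "a = c + d"
begin

section \<open>Contiguity in \<open>M\<close> and the Wilf-Zeilberger identity\<close>

lemma shift_nonzero:
  "1 + of_nat M + c + of_nat N \<noteq> 0" "1 + of_nat M + d + of_nat N \<noteq> 0" "1 + of_nat M + a + of_nat N \<noteq> 0"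
  "1 + of_nat M - c \<noteq> 0" "1 + of_nat M - d \<noteq> 0" "1 + of_nat M - a \<noteq> 0"
  "1 + of_nat M + c \<noteq> 0" "1 + of_nat M + d \<noteq> 0" "1 + of_nat M + a \<noteq> 0"
  using one_plus_nat_plus_nonzero[of c "M+N"] one_plus_nat_plus_nonzero[of d "M+N"] one_plus_nat_plus_nonzero[of a "M+N"]
    one_plus_nat_plus_nonzero[of "-c" M] one_plus_nat_plus_nonzero[of "-d" M] one_plus_nat_plus_nonzero[of "-a" M]
    one_plus_nat_plus_nonzero[of "c" M] one_plus_nat_plus_nonzero[of "d" M] one_plus_nat_plus_nonzero[of "a" M] na nc nd
  by (auto simp: algebra_simps)

lemma numerator_shift_nonzero: "a + of_nat M \<noteq> 0"
  using a0 shift_nonzero(9)[of "M-1"] by (cases M) (auto simp: algebra_simps)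

text \<open>Raising \<open>M\<close> by 1 moves every \<open>M\<close>-dependent Pochhammer symbol
  by one index, so the quotient of the two products telescopes to a rational function of
  \<open>N\<close>. Denominators are cleared for the induction.\<close>

lemma vwp_shift:
  "vwp a c d (Suc M) N * (1 + of_nat M + of_nat N) * (1 + of_nat M + c + of_nat N) * (1 + of_nat M + d + of_nat N) * (a + of_nat M)
   = vwp a c d M N * (a + of_nat M + of_nat N) * (1 + of_nat M) * (1 + of_nat M + c) * (1 + of_nat M + d)"
proof (induction N)
  case 0
  then show ?case by (simp add: vwp_def algebra_simps)
next
  case (Suc N)
  define A where "A = a + of_nat M"
  define p where "p = (1 + of_nat M :: complex)"
  define n where "n = (of_nat N :: complex)"
  define V where "V = vwp a c d M N"
  define V' where "V' = vwp a c d (Suc M) N"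
  have nn: "p + n \<noteq> 0" "1 + n \<noteq> 0" "p + 1 + n \<noteq> 0"
    using one_plus_nat_plus_nonzero[of 0 "M + N"] one_plus_nat_plus_nonzero[of 0 N] one_plus_nat_plus_nonzero[of 0 "M + N + 1"]
    by (auto simp: p_def n_def algebra_simps)
  have nn2: "p + c + n \<noteq> 0" "p + d + n \<noteq> 0" "p + c + 1 + n \<noteq> 0" "p + d + 1 + n \<noteq> 0"
    using shift_nonzero(1-3)[of M N] shift_nonzero(1-3)[of M "Suc N"] by (auto simp: p_def n_def algebra_simps)
  have IH: "V' * (p + n) * (p + c + n) * (p + d + n) * A = V * (A + n) * p * (p + c) * (p + d)"
    using Suc by (simp add: V_def V'_def A_def p_def n_def)
  have S: "vwp a c d M (Suc N) = V * ((A + n) * (a + n) * (c + n) * (d + n) / ((1+n) * (p+n) * (p+c+n) * (p+d+n)))"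
    unfolding vwp_Suc by (simp add: V_def A_def p_def n_def)
  have S': "vwp a c d (Suc M) (Suc N) = V' * ((A + n + 1) * (a + n) * (c + n) * (d + n) / ((1+n) * (p+1+n) * (p+c+1+n) * (p+d+1+n)))"
    unfolding vwp_Suc by (simp add: V'_def A_def p_def n_def algebra_simps)
  have "vwp a c d (Suc M) (Suc N) * (p+1+n) * (p+c+1+n) * (p+d+1+n) * A = 
     V' * A * ((A + n + 1) * (a + n) * (c + n) * (d + n) / (1+n))"
    unfolding S' using nn nn2 by (simp add: divide_simps)
  also have "V' * A = V * (A + n) * p * (p + c) * (p + d) / ((p + n) * (p + c + n) * (p + d + n))"
    by (subst nonzero_eq_divide_eq) (use IH nn nn2 in \<open>simp_all add: mult_ac\<close>)
  also have "\<dots> * ((A + n + 1) * (a + n) * (c + n) * (d + n) / (1+n)) = 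
     vwp a c d M (Suc N) * (A + n + 1) * p * (p+c) * (p+d)"
    unfolding S by (simp add: mult_ac)
  finally show ?case by (simp add: A_def p_def n_def algebra_simps)
qed

lemma wz_pair:
  "vwp_term a c d M N - vwp_ratio a c d M * vwp_term a c d (Suc M) N =
   vwp_cert a c d M (Suc N) - vwp_cert a c d M N"
proof -
  define A where "A = a + of_nat M"
  define p where "p = (1 + of_nat M :: complex)"
  define n where "n = (of_nat N :: complex)"
  define V where "V = vwp a c d M N"
  have nn: "p + n \<noteq> 0" "1 + n \<noteq> 0" "p \<noteq> 0"
    using one_plus_nat_plus_nonzero[of 0 "M + N"] one_plus_nat_plus_nonzero[of 0 N] one_plus_nat_plus_nonzero[of 0 M]
    by (auto simp: p_def n_def algebra_simps)
  have nn2: "p + c + n \<noteq> 0" "p + d + n \<noteq> 0" "p - a \<noteq> 0" "p + c \<noteq> 0" "p + d \<noteq> 0" "A + 1 \<noteq> 0" "A \<noteq> 0"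
    using shift_nonzero(1-3)[of M N] shift_nonzero(4-)[of M] numerator_shift_nonzero[of M] by (auto simp: p_def n_def A_def algebra_simps)
  have Aeq: "A = a + p - 1" by (simp add: A_def p_def)
  \<comment> \<open>\<open>D\<close> is the denominator shared by the shift in \<open>M\<close> and
    the step in \<open>N\<close>. Both sides then become multiples of
    \<open>V / (A * D * (p - a))\<close>.\<close>
  define D where "D = (p+n) * (p+c+n) * (p+d+n)"
  have D0: "D \<noteq> 0" using nn nn2 by (simp add: D_def)
  have "vwp a c d (Suc M) N * D * A = V * (A + n) * p * (p+c) * (p+d)"
    using vwp_shift[of M N] by (simp add: A_def p_def n_def V_def D_def algebra_simps)
  then have V': "vwp a c d (Suc M) N = V * (A + n) * p * (p+c) * (p+d) / (D * A)"
    using D0 nn2 by (simp add: divide_simps algebra_simps)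
  have r: "vwp_ratio a c d M = (A+1) * (p-c) * (p-d) / ((p+c) * (p+d) * (p-a))"
    by (simp add: vwp_ratio_def A_def p_def algebra_simps)
  have t: "vwp_term a c d M N = V * (A + 2*n) / A"
    using nn2 by (simp add: vwp_term_def V_def A_def[symmetric] n_def[symmetric] divide_simps)
  have t': "vwp_term a c d (Suc M) N = V * (A + n) * p * (p+c) * (p+d) / (D * A) * ((A + 1 + 2*n) / (A+1))"
    using nn2 D0 unfolding vwp_term_def V' 
    by (simp add: A_def[symmetric] n_def[symmetric] divide_simps add_ac)
  have lhs: "vwp_term a c d M N - vwp_ratio a c d M * vwp_term a c d (Suc M) N =
     V / (A * D * (p-a)) * ((p-a) * (A+2*n) * D - (A+n) * (A+1+2*n) * p * (p-c) * (p-d))"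
  proof -
    have "vwp_ratio a c d M * vwp_term a c d (Suc M) N = V * (A+n) * (A+1+2*n) * p * (p-c) * (p-d) / (A * D * (p-a))"
      unfolding r t' using nn2 by (simp add: mult_ac)
    moreover have "vwp_term a c d M N = V / (A * D * (p-a)) * ((p-a) * (A+2*n) * D)"
      unfolding t using nn2 D0 by simp
    ultimately show ?thesis by (simp add: right_diff_distrib mult_ac)
  qed
  have S: "vwp a c d M (Suc N) = V * ((A + n) * (a + n) * (c + n) * (d + n) / ((1+n) * D))"
    unfolding vwp_Suc by (simp add: V_def A_def p_def n_def D_def mult_ac)
  have c1: "vwp_cert a c d M (Suc N) = V / (A * D * (p-a)) * (- (n + 2*p) * (A + n) * (a + n) * (c + n) * (d + n))"
  proof -
    have "vwp_cert a c d M (Suc N) = - (1+n) * (n + 2*p) * vwp a c d M (Suc N) / (A * (p - a))"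
      by (simp add: vwp_cert_def A_def p_def n_def algebra_simps)
    \<comment> \<open>The factor \<open>1 + n\<close> of the certificate at \<open>Suc N\<close>
      cancels the one in the denominator from \<open>vwp_Suc\<close>.\<close>
    also have "\<dots> = (1+n) / (1+n) * (V / (A * D * (p-a)) * (- (n + 2*p) * (A + n) * (a + n) * (c + n) * (d + n)))"
      unfolding S times_divide_eq_right times_divide_eq_left divide_divide_eq_left by (simp add: algebra_simps)
    finally show ?thesis using nn by simp
  qed
  have c0: "vwp_cert a c d M N = V / (A * D * (p-a)) * (- n * (n + 2*p - 1) * D)"
  proof -
    have "vwp_cert a c d M N = - n * (n + 2*p - 1) * V / (A * (p - a))"
      by (simp add: vwp_cert_def A_def p_def n_def V_def algebra_simps)
    then show ?thesis using D0 by simp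
  qed
  \<comment> \<open>What remains is a polynomial identity in \<open>c\<close>, \<open>d\<close>,
    \<open>p\<close>, \<open>n\<close>, once \<open>A = a + p - 1\<close> and
    \<open>a = c + d\<close> are substituted.\<close>
  have "(p-a) * (A+2*n) * D - (A+n) * (A+1+2*n) * p * (p-c) * (p-d) =
     - (n + 2*p) * (A + n) * (a + n) * (c + n) * (d + n) + n * (n + 2*p - 1) * D"
    unfolding D_def Aeq acd by algebra
  then show ?thesis
    unfolding lhs c1 c0 by (simp only: right_diff_distrib[symmetric]) simp
qed

section \<open>Bounds and termwise limits for the series\<close>

text \<open>The first three bounds do not depend on \<open>M\<close> and serve for domination; the
  fourth decays in \<open>M\<close> and serves for termwise limits. The exponential form, from
  \<open>1 - x \<le> exp (- x)\<close>, lets the exponents add up in products.\<close>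

lemma norm_vwp_factors:
  fixes i M :: nat and z :: complex
  shows "norm ((a + of_nat M + of_nat i) / (1 + of_nat M + of_nat i)) \<le> 1"
    and "norm ((a + of_nat i) / (1 + of_nat i)) \<le> exp (- (19/20) / (real i + 1))"
    and "norm z \<le> 1/20 \<Longrightarrow> norm ((z + of_nat i) / (1 + of_nat M + z + of_nat i)) \<le> exp (- (18/20) / (real i + 1))"
    and "norm z \<le> 1/20 \<Longrightarrow> norm ((z + of_nat i) / (1 + of_nat M + z + of_nat i)) \<le> (real i + 1) / (real M + 1/2)"
proof -
  have e1: "1 - x \<le> exp (- x)" for x :: real
    using exp_ge_add_one_self[of "-x"] by simp
  have na': "norm (a + of_nat k) \<le> real k + 1/20" for k
    using norm_triangle_ineq[of a "of_nat k"] na by simp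
  have n1: "norm (1 + of_nat k :: complex) = real k + 1" for k
    by (metis Suc_eq_plus1_left norm_of_nat of_nat_1 of_nat_Suc of_nat_add add.commute)
  show "norm ((a + of_nat M + of_nat i) / (1 + of_nat M + of_nat i)) \<le> 1"
    using na'[of "M+i"] n1[of "M+i"] by (simp add: norm_divide add_ac)
  have "norm ((a + of_nat i) / (1 + of_nat i)) \<le> (real i + 1/20) / (real i + 1)"
    using na'[of i] n1[of i] by (simp add: norm_divide divide_right_mono)
  also have "\<dots> = 1 - (19/20) / (real i + 1)"
    by (simp add: field_simps)
  also have "\<dots> \<le> exp (- ((19/20) / (real i + 1)))" by (rule e1)
  finally show "norm ((a + of_nat i) / (1 + of_nat i)) \<le> exp (- (19/20) / (real i + 1))" by simp
  assume z: "norm z \<le> 1/20"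
  have nz: "norm (z + of_nat k) \<le> real k + 1/20" for k
    using norm_triangle_ineq[of z "of_nat k"] z by simp
  have nz1: "norm (1 + of_nat M + z + of_nat i) \<ge> real M + real i + 19/20"
    using norm_triangle_ineq2[of "1 + of_nat (M+i)" "-z"] n1[of "M+i"] z by (simp add: algebra_simps)
  have le: "norm ((z + of_nat i) / (1 + of_nat M + z + of_nat i)) \<le> (real i + 1/20) / (real M + real i + 19/20)"
    unfolding norm_divide using nz nz1 by (intro frac_le) auto
  \<comment> \<open>Dropping \<open>M\<close> from the denominator makes the bound uniform in
    \<open>M\<close>.\<close>
  also have "\<dots> \<le> (real i + 1/20) / (real i + 19/20)"
    by (intro divide_left_mono) auto
  also have "\<dots> = 1 - (18/20) / (real i + 19/20)" by (simp add: field_simps)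
  also have "\<dots> \<le> 1 - (18/20) / (real i + 1)" by (simp add: frac_le)
  also have "\<dots> \<le> exp (- ((18/20) / (real i + 1)))" by (rule e1)
  finally show "norm ((z + of_nat i) / (1 + of_nat M + z + of_nat i)) \<le> exp (- (18/20) / (real i + 1))" by simp
  have "(real i + 1/20) / (real M + real i + 19/20) \<le> (real i + 1) / (real M + 1/2)"
    by (intro frac_le) auto
  with le show "norm ((z + of_nat i) / (1 + of_nat M + z + of_nat i)) \<le> (real i + 1) / (real M + 1/2)" by simp
qed

lemma vwp_Suc':
  "vwp a c d M (Suc N) = vwp a c d M N * (((a + of_nat M + of_nat N) / (1 + of_nat M + of_nat N)) *
     ((a + of_nat N) / (1 + of_nat N)) * ((c + of_nat N) / (1 + of_nat M + c + of_nat N)) *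
     ((d + of_nat N) / (1 + of_nat M + d + of_nat N)))"
  unfolding vwp_Suc by (simp add: mult_ac)

text \<open>Induction step for \<open>norm_vwp_le\<close>:
  \<open>ln (N + 2) - ln (N + 1) \<le> 1 / (N + 1)\<close> and 5/2 < 11/4. As 5/2 exceeds 2, the
  bound times \<open>N\<close> is summable and the bound times \<open>N^2\<close> tends to
  0.\<close>

lemma powr_times_exp_le:
  "(real N + 1) powr (-(5/2)) * exp (- (11/4) / (real N + 1)) \<le> (real (Suc N) + 1) powr (-(5/2))"
proof -
  have l0: "ln (1 + 1 / (real N + 1)) \<le> 1 / (real N + 1)"
    by (rule ln_add_one_self_le_self) simp
  have l: "ln (real N + 2) - ln (real N + 1) \<le> 1 / (real N + 1)"
  proof -
    have "1 + 1 / (real N + 1) = (real N + 2) / (real N + 1)" by (simp add: field_simps)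
    with l0 show ?thesis using ln_div[of "real N + 2" "real N + 1"] by simp
  qed
  have "- (5/2) * ln (real N + 1) + - (11/4) / (real N + 1) \<le> - (5/2) * ln (real (Suc N) + 1)"
  proof -
    define t where "t = 1 / (real N + 1)"
    have "t > 0" "ln (real N + 2) - ln (real N + 1) \<le> t" "- (11/4) / (real N + 1) = - (11/4) * t"
      "real (Suc N) + 1 = real N + 2"
      using l by (simp_all add: t_def)
    then show ?thesis by (simp only:)
  qed
  moreover have "(real N + 1) powr (-(5/2)) = exp (- (5/2) * ln (real N + 1))"
    "(real (Suc N) + 1) powr (-(5/2)) = exp (- (5/2) * ln (real (Suc N) + 1))"
    by (simp_all add: powr_def)
  ultimately show ?thesis
    by (simp only: exp_add[symmetric] exp_le_cancel_iff)
qed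

lemma norm_vwp_le: "norm (vwp a c d M N) \<le> (real N + 1) powr (-(5/2))"
proof (induction N)
  case 0
  then show ?case by (simp add: vwp_def)
next
  case (Suc N)
  have "norm (vwp a c d M (Suc N)) \<le> (real N + 1) powr (-(5/2)) *
     (1 * exp (- (19/20) / (real N + 1)) * exp (- (18/20) / (real N + 1)) * exp (- (18/20) / (real N + 1)))"
    unfolding vwp_Suc' norm_mult
    by (intro mult_mono Suc norm_vwp_factors nc nd mult_nonneg_nonneg norm_ge_zero) auto
  also have "1 * exp (- (19/20) / (real N + 1)) * exp (- (18/20) / (real N + 1)) * exp (- (18/20) / (real N + 1)) =
      exp (- (11/4) / (real N + 1))"
    proof -
    have "- (19/20) / k + - (18/20) / k + - (18/20) / k = - (11/4) / k" for k :: real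
      by (cases "k = 0") (simp_all add: field_simps)
    then show ?thesis by (simp only: mult_1 exp_add[symmetric])
  qed
  finally show ?case using powr_times_exp_le[of N] by simp
qed

text \<open>The last factor containing \<open>d\<close> carries the decay in \<open>M\<close>, by
  the fourth bound of \<open>norm_vwp_factors\<close>; everything else is bounded by 1.\<close>

lemma vwp_tendsto_0: "(\<lambda>M. vwp a c d M (Suc N)) \<longlonglongrightarrow> 0"
proof (rule Lim_null_comparison)
  show "\<forall>\<^sub>F M in sequentially. norm (vwp a c d M (Suc N)) \<le> (real N + 1) / (real M + 1/2)"
  proof (rule always_eventually, rule allI)
    fix M
    have e: "exp (- x / (real N + 1)) \<le> 1" if "x \<ge> 0" for x using that by simp
    have "norm (vwp a c d M N) \<le> (real N + 1) powr (-(5/2))" by (rule norm_vwp_le)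
    also have "\<dots> \<le> 1" by (simp add: powr_minus inverse_le_1_iff ge_one_powr_ge_zero)
    finally have "norm (vwp a c d M (Suc N)) \<le> 1 * (1 * 1 * 1 * ((real N + 1) / (real M + 1/2)))"
      unfolding vwp_Suc' norm_mult
      by (intro mult_mono norm_vwp_factors nc nd mult_nonneg_nonneg norm_ge_zero
           order.trans[OF norm_vwp_factors(2) e] order.trans[OF norm_vwp_factors(3) e]) auto
    then show "norm (vwp a c d M (Suc N)) \<le> (real N + 1) / (real M + 1/2)" by simp
  qed
  show "(\<lambda>M. (real N + 1) / (real M + 1/2)) \<longlonglongrightarrow> 0"
    by real_asymp
qed

text \<open>The constant \<open>K\<close> is kept free because two choices occur: one depending on
  \<open>M\<close> for summability, including \<open>M = 0\<close> where \<open>a\<close> may be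
  tiny, and \<open>K = 2\<close> for domination over all \<open>M \<ge> 1\<close>.\<close>

lemma norm_vwp_term_le:
  assumes "K > 0" "1 / norm (a + of_nat M) \<le> K"
  shows "norm (vwp_term a c d M N) \<le> (1 + 2 * K) * (real N + 1) powr (-(3/2))"
proof -
  have "norm (1 + 2 * of_nat N / (a + of_nat M)) \<le> 1 + norm (2 * of_nat N / (a + of_nat M))"
    using norm_triangle_ineq[of 1 "2 * of_nat N / (a + of_nat M)"] by simp
  also have "norm (2 * of_nat N / (a + of_nat M)) = 2 * real N * (1 / norm (a + of_nat M))"
    by (simp add: norm_divide norm_mult)
  also have "\<dots> \<le> 2 * real N * K" using assms by (intro mult_left_mono) auto
  also have "1 + 2 * real N * K \<le> (1 + 2 * K) * (real N + 1)"
    using assms by (simp add: algebra_simps)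
  finally have "norm (vwp_term a c d M N) \<le> (real N + 1) powr (-(5/2)) * ((1 + 2 * K) * (real N + 1))"
    unfolding vwp_term_def norm_mult by (intro mult_mono norm_vwp_le) auto
  also have "\<dots> = (1 + 2 * K) * ((real N + 1) powr (-(5/2)) * (real N + 1) powr 1)"
    by simp
  also have "\<dots> = (1 + 2 * K) * (real N + 1) powr (-(3/2))"
    unfolding powr_add[symmetric] by simp
  finally show ?thesis .
qed

lemma summable_powr_shift: "summable (\<lambda>N. (real N + 1) powr (-(3/2)))"
proof -
  have "summable (\<lambda>N. real N powr (-(3/2)))" by (subst summable_real_powr_iff) auto
  then have "summable (\<lambda>N. real (Suc N) powr (-(3/2)))" by (subst summable_Suc_iff)
  then show ?thesis by (simp add: add.commute)
qed

lemma summable_vwp_term: "summable (\<lambda>N. norm (vwp_term a c d M N))"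
proof (rule summable_comparison_test')
  show "summable (\<lambda>N. (1 + 2 * (1 / norm (a + of_nat M))) * (real N + 1) powr (-(3/2)))"
    by (intro summable_mult summable_powr_shift)
  show "norm (norm (vwp_term a c d M N)) \<le> (1 + 2 * (1 / norm (a + of_nat M))) * (real N + 1) powr (-(3/2))" for N
    using norm_vwp_term_le[of "1 / norm (a + of_nat M)" M N] numerator_shift_nonzero[of M] by simp
qed

lemma vwp_cert_tendsto_0: "(\<lambda>N. vwp_cert a c d M N) \<longlonglongrightarrow> 0"
proof (rule Lim_null_comparison)
  define K where "K = norm (a + of_nat M) * norm (1 + of_nat M - a)"
  have K: "K > 0" using numerator_shift_nonzero[of M] shift_nonzero(6)[of M] by (simp add: K_def)
  show "\<forall>\<^sub>F N in sequentially. norm (vwp_cert a c d M N) \<le> real N * (real N + 2 * real M + 1) * (real N + 1) powr (-(5/2)) / K"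
  proof (rule always_eventually, rule allI)
    fix N
    have "norm (of_nat N + 2 * of_nat M + 1 :: complex) = real N + 2 * real M + 1"
      using norm_of_nat[of "N + 2 * M + 1", where 'a=complex] by (simp add: add_ac)
    then have "norm (vwp_cert a c d M N) = real N * (real N + 2 * real M + 1) * norm (vwp a c d M N) / K"
      by (simp add: vwp_cert_def norm_mult norm_divide K_def)
    also have "\<dots> \<le> real N * (real N + 2 * real M + 1) * (real N + 1) powr (-(5/2)) / K"
      using K by (intro divide_right_mono mult_left_mono norm_vwp_le) auto
    finally show "norm (vwp_cert a c d M N) \<le> real N * (real N + 2 * real M + 1) * (real N + 1) powr (-(5/2)) / K" .
  qed
  show "(\<lambda>N. real N * (real N + 2 * real M + 1) * (real N + 1) powr (-(5/2)) / K) \<longlonglongrightarrow> 0"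
    using K by real_asymp
qed

section \<open>Summation by letting the shift tend to infinity\<close>

text \<open>Summing \<open>wz_pair\<close> over \<open>N\<close> telescopes. The boundary term
  vanishes at infinity by \<open>vwp_cert_tendsto_0\<close>, and at \<open>N = 0\<close> because of
  the factor \<open>N\<close> in the certificate.\<close>

lemma vwp_series_step:
  "(\<Sum>N. vwp_term a c d M N) = vwp_ratio a c d M * (\<Sum>N. vwp_term a c d (Suc M) N)"
proof -
  note s = summable_norm_cancel[OF summable_vwp_term]
  have "(\<lambda>N. vwp_term a c d M N - vwp_ratio a c d M * vwp_term a c d (Suc M) N) sums (0 - vwp_cert a c d M 0)"
    unfolding wz_pair by (rule telescope_sums[OF vwp_cert_tendsto_0])
  moreover have "(\<lambda>N. vwp_term a c d M N - vwp_ratio a c d M * vwp_term a c d (Suc M) N) sums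
     ((\<Sum>N. vwp_term a c d M N) - vwp_ratio a c d M * (\<Sum>N. vwp_term a c d (Suc M) N))"
    by (intro sums_diff sums_mult summable_sums s)
  ultimately have "(\<Sum>N. vwp_term a c d M N) - vwp_ratio a c d M * (\<Sum>N. vwp_term a c d (Suc M) N) = 0 - vwp_cert a c d M 0"
    by (rule sums_unique2[symmetric])
  then show ?thesis by (simp add: vwp_cert_def)
qed

lemma vwp_series_prod:
  "(\<Sum>N. vwp_term a c d 0 N) = (\<Prod>m<M. vwp_ratio a c d m) * (\<Sum>N. vwp_term a c d M N)"
proof (induction M)
  case (Suc M)
  then show ?case using vwp_series_step[of M] by simp
qed simp

lemma vwp_series_tendsto_1: "(\<lambda>M. \<Sum>N. vwp_term a c d M N) \<longlonglongrightarrow> 1"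
proof -
  have "(\<lambda>M. \<Sum>N. vwp_term a c d M N) \<longlonglongrightarrow> (\<Sum>N. if N = 0 then 1 else 0)"
  proof (rule tannerys_theorem[THEN conjunct2, THEN conjunct2])
    show "(\<lambda>M. vwp_term a c d M N) \<longlonglongrightarrow> (if N = 0 then 1 else 0)" for N
    proof (cases N)
      case 0
      then show ?thesis by (simp add: vwp_term_def vwp_def)
    next
      case (Suc n)
      have "filterlim (\<lambda>M. a + of_nat M :: complex) at_infinity sequentially"
        by (intro tendsto_add_filterlim_at_infinity[OF tendsto_const] tendsto_of_nat)
      then have "(\<lambda>M. 1 + 2 * of_nat N / (a + of_nat M)) \<longlonglongrightarrow> 1 + 0"
        by (intro tendsto_intros tendsto_divide_0[OF tendsto_const])
      from tendsto_mult[OF vwp_tendsto_0[of n] this] show ?thesis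
        using Suc by (simp add: vwp_term_def)
    qed
    show "\<forall>\<^sub>F (N, M) in at_top \<times>\<^sub>F sequentially. norm (vwp_term a c d M N) \<le> (1 + 2 * 2) * (real N + 1) powr (-(3/2))"
    proof -
      \<comment> \<open>For \<open>M \<ge> 1\<close> the norm of \<open>a + M\<close> is at least
        19/20, so \<open>K = 2\<close> is admissible; the case \<open>M = 0\<close> does not affect
        the limit.\<close>
      have "norm (vwp_term a c d M N) \<le> (1 + 2 * 2) * (real N + 1) powr (-(3/2))" if "M \<ge> 1" for M N
      proof (rule norm_vwp_term_le)
        have "norm (a + of_nat M) \<ge> real M - 1/20"
          using norm_triangle_ineq2[of "of_nat M" "-a"] na by (simp add: add.commute)
        then show "1 / norm (a + of_nat M) \<le> 2"
          using that numerator_shift_nonzero[of M] by (simp add: field_simps)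
      qed simp
      then show ?thesis
        unfolding eventually_prod_filter
        by (intro exI[of _ "\<lambda>_. True"] exI[of _ "\<lambda>M. M \<ge> 1"]) (auto simp: eventually_at_top_linorder)
    qed
    show "summable (\<lambda>N. (1 + 2 * 2) * (real N + 1) powr (-(3/2)))"
      by (intro summable_mult summable_powr_shift)
  qed simp
  also have "(\<Sum>N. if N = 0 then 1 else 0 :: complex) = 1"
    using suminf_finite[of "{0::nat}" "\<lambda>N. if N = 0 then 1 else 0 :: complex"] by simp
  finally show ?thesis .
qed

text \<open>\<open>Gamma_series z n\<close> is \<open>n! n^z\<close> over the Pochhammer symbol with
  \<open>n + 1\<close> factors. In the quotient of six such series the factorials and powers of
  \<open>n\<close> cancel, leaving exactly the product of the ratios.\<close>

lemma vwp_ratio_prod_tendsto: "(\<lambda>M. \<Prod>m<M. vwp_ratio a c d m) \<longlonglongrightarrow> V_cl (-a) c d"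
proof -
  have G: "Gamma (1 + z) \<noteq> 0" "pochhammer (1+z) n \<noteq> 0" if "norm z \<le> 1/20" for z :: complex and n
  proof -
    have nz': "1 + of_nat k + z \<noteq> 0" for k using one_plus_nat_plus_nonzero[of z k] that by simp
    show "pochhammer (1+z) n \<noteq> 0" using nz' by (auto simp: pochhammer_prod add_ac)
    show "Gamma (1 + z) \<noteq> 0" 
      unfolding Gamma_eq_zero_iff 
    proof
      assume "1 + z \<in> \<int>\<^sub>\<le>\<^sub>0"
      then obtain k where "1 + z = - of_nat k" by (elim nonpos_Ints_cases')
      then have "(1 + z) + of_nat k = 0" by simp
      then have "1 + of_nat k + z = 0" by (simp only: add_ac)
      then show False using nz'[of k] by simp
    qed
  qed
  have "(\<lambda>n. (Gamma_series (1 + (-a)) n * Gamma_series (1 + c) n * Gamma_series (1 + d) n) /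
     (Gamma_series (1 + a) n * Gamma_series (1 + (-c)) n * Gamma_series (1 + (-d)) n)) \<longlonglongrightarrow>
     (Gamma (1 + (-a)) * Gamma (1 + c) * Gamma (1 + d)) / (Gamma (1 + a) * Gamma (1 + (-c)) * Gamma (1 + (-d)))"
    using G(1)[of a] G(1)[of "-c"] G(1)[of "-d"] na nc nd
    by (intro tendsto_intros) auto
  also have "(Gamma (1 + (-a)) * Gamma (1 + c) * Gamma (1 + d)) / (Gamma (1 + a) * Gamma (1 + (-c)) * Gamma (1 + (-d))) = V_cl (-a) c d"
    by (simp add: V_cl_def)
  also have "(\<lambda>n. (Gamma_series (1 + (-a)) n * Gamma_series (1 + c) n * Gamma_series (1 + d) n) /
     (Gamma_series (1 + a) n * Gamma_series (1 + (-c)) n * Gamma_series (1 + (-d)) n)) =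
     (\<lambda>n. \<Prod>m<Suc n. vwp_ratio a c d m)"
  proof
    fix n
    define L where "L = (of_real (ln (of_nat n)) :: complex)"
    have gs: "Gamma_series (1+z) n = fact n * exp L * exp (z * L) / pochhammer (1+z) (Suc n)" for z
      by (simp add: Gamma_series_def L_def exp_add ring_distribs)
    \<comment> \<open>The powers of \<open>n\<close> cancel because \<open>a = c + d\<close>, which
      is the condition \<open>s + t + u = 0\<close> on the arguments of \<open>V_cl\<close>.\<close>
    have e: "exp (- a * L) * exp (c * L) * exp (d * L) = 1" "exp (a * L) * exp (-c * L) * exp (-d * L) = 1"
      by (simp_all add: exp_add[symmetric] acd ring_distribs)
    have pp: "pochhammer (1+z) (Suc n) = (\<Prod>m<Suc n. 1 + of_nat m + z)" for z :: complex
      by (simp only: pochhammer_prod atLeast0LessThan) (simp add: add_ac)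
    have "(Gamma_series (1 + (-a)) n * Gamma_series (1 + c) n * Gamma_series (1 + d) n) =
      (fact n * exp L)^3 * (exp (- a * L) * exp (c * L) * exp (d * L)) / 
      (pochhammer (1+(-a)) (Suc n) * pochhammer (1+c) (Suc n) * pochhammer (1+d) (Suc n))"
      unfolding gs by (simp add: power3_eq_cube)
    moreover have "(Gamma_series (1 + a) n * Gamma_series (1 + (-c)) n * Gamma_series (1 + (-d)) n) =
      (fact n * exp L)^3 * (exp (a * L) * exp (-c * L) * exp (-d * L)) / 
      (pochhammer (1+a) (Suc n) * pochhammer (1+(-c)) (Suc n) * pochhammer (1+(-d)) (Suc n))"
      unfolding gs by (simp add: power3_eq_cube)
    ultimately have "(Gamma_series (1 + (-a)) n * Gamma_series (1 + c) n * Gamma_series (1 + d) n) /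
     (Gamma_series (1 + a) n * Gamma_series (1 + (-c)) n * Gamma_series (1 + (-d)) n) = 
      (pochhammer (1+a) (Suc n) * pochhammer (1+(-c)) (Suc n) * pochhammer (1+(-d)) (Suc n)) /
      (pochhammer (1+(-a)) (Suc n) * pochhammer (1+c) (Suc n) * pochhammer (1+d) (Suc n))"
      unfolding e by simp
    also have "\<dots> = (\<Prod>m<Suc n. vwp_ratio a c d m)"
      unfolding pp vwp_ratio_def prod.distrib[symmetric] prod_dividef[symmetric]
      by (rule prod.cong) (simp_all add: algebra_simps)
    finally show "(Gamma_series (1 + (-a)) n * Gamma_series (1 + c) n * Gamma_series (1 + d) n) /
     (Gamma_series (1 + a) n * Gamma_series (1 + (-c)) n * Gamma_series (1 + (-d)) n) = (\<Prod>m<Suc n. vwp_ratio a c d m)" .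
  qed
  finally show ?thesis by (rule LIMSEQ_imp_Suc)
qed

lemma vwp_sums: "(\<lambda>N. vwp_term a c d 0 N) sums V_cl (-a) c d"
proof -
  have "(\<lambda>M. (\<Prod>m<M. vwp_ratio a c d m) * (\<Sum>N. vwp_term a c d M N)) \<longlonglongrightarrow> V_cl (-a) c d * 1"
    by (intro tendsto_mult vwp_ratio_prod_tendsto vwp_series_tendsto_1)
  then have "(\<lambda>M. \<Sum>N. vwp_term a c d 0 N) \<longlonglongrightarrow> V_cl (-a) c d"
    unfolding vwp_series_prod[symmetric] by simp
  then have "(\<Sum>N. vwp_term a c d 0 N) = V_cl (-a) c d"
    by (simp add: LIMSEQ_const_iff)
  then show ?thesis
    using summable_sums[OF summable_norm_cancel[OF summable_vwp_term]] by metis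
qed

end

section \<open>Nested sums\<close>

definition increasing_lists :: "nat \<Rightarrow> nat \<Rightarrow> nat list set" where
  "increasing_lists N l = {ns. length ns = l \<and> sorted_wrt (<) ns \<and> set ns \<subseteq> {0<..<N}}"

text \<open>A truncated multiple zeta value (multiple harmonic sum). All indices lie strictly below
  \<open>N\<close>, so that \<open>N\<close> itself can be appended as the largest index.\<close>

definition nested_sum :: "nat \<Rightarrow> nat list \<Rightarrow> real" where
  "nested_sum N rs = (\<Sum>ns\<in>increasing_lists N (length rs). \<Prod>i<length rs. 1 / real (ns ! i) ^ (rs ! i))"

definition compositions12 :: "nat \<Rightarrow> nat list set" where
  "compositions12 r = {rs. set rs \<subseteq> {1, 2} \<and> sum_list rs = r}"

text \<open>
  The coefficient of \<open>y\<^sup>r\<close> in \<open>\<Prod>\<^bsub>0<n<N\<^esub> (1 + y/n)\<^sup>2\<close>: each factor \<open>1 + 2y/n + y\<^sup>2/n\<^sup>2\<close> contributes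
  an entry 1 with weight 2, an entry 2 with weight 1, or nothing.
\<close>

definition sq_coeff :: "nat \<Rightarrow> nat \<Rightarrow> real" where
  "sq_coeff N r = (\<Sum>rs\<in>compositions12 r. 2 ^ count_list rs 1 * nested_sum N rs)"

section \<open>Recursion for truncated multiple zeta values\<close>

lemma finite_increasing_lists: "finite (increasing_lists N l)"
  by (rule finite_subset[OF _ finite_lists_length_eq[of "{0<..<N}" l]]) (auto simp: increasing_lists_def)

lemma increasing_lists_0: "increasing_lists N 0 = {[]}"
  by (auto simp: increasing_lists_def)

lemma increasing_lists_1: "increasing_lists (Suc 0) (Suc l) = {}"
  by (auto simp: increasing_lists_def length_Suc_conv)

text \<open>A list either avoids \<open>N\<close> or ends in it, since the last entry is the
  largest. Entries are positive, hence \<open>N > 0\<close>.\<close>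

lemma increasing_lists_Suc:
  assumes "N > 0"
  shows "increasing_lists (Suc N) (Suc l) = increasing_lists N (Suc l) \<union> (\<lambda>ns. ns @ [N]) ` increasing_lists N l"
proof (intro equalityI subsetI)
  fix ns assume ns: "ns \<in> increasing_lists (Suc N) (Suc l)"
  then obtain ms x where m: "ns = ms @ [x]"
    by (metis (mono_tags, lifting) increasing_lists_def length_Suc_conv_rev mem_Collect_eq)
  show "ns \<in> increasing_lists N (Suc l) \<union> (\<lambda>ns. ns @ [N]) ` increasing_lists N l"
  proof (cases "x = N")
    case True
    then have "ms \<in> increasing_lists N l"
      using ns by (auto simp: increasing_lists_def m sorted_wrt_append)
    then show ?thesis using True m by auto
  next
    case False
    then have "x < N" "\<And>y. y \<in> set ms \<Longrightarrow> 0 < y \<and> y < x" "0 < x" "sorted_wrt (<) ms" "length ms = l"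
      using ns by (auto simp: increasing_lists_def m sorted_wrt_append)
    then have "ns \<in> increasing_lists N (Suc l)"
      by (force simp: increasing_lists_def m sorted_wrt_append)
    then show ?thesis by simp
  qed
next
  fix ns assume "ns \<in> increasing_lists N (Suc l) \<union> (\<lambda>ns. ns @ [N]) ` increasing_lists N l"
  then show "ns \<in> increasing_lists (Suc N) (Suc l)"
    using assms by (auto simp: increasing_lists_def sorted_wrt_append less_Suc_eq subset_eq)
qed

lemma prod_snoc:
  assumes "length ns = length rs"
  shows "(\<Prod>i<length (rs @ [q]). 1 / real ((ns @ [n]) ! i) ^ ((rs @ [q]) ! i)) =
    (\<Prod>i<length rs. 1 / real (ns ! i) ^ (rs ! i)) * (1 / real n ^ q)"
  using assms by (simp add: nth_append)

lemma nested_sum_Nil [simp]: "nested_sum N [] = 1"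
  by (simp add: nested_sum_def increasing_lists_0)

lemma nested_sum_snoc_1: "nested_sum (Suc 0) (rs @ [q]) = 0"
  by (simp add: nested_sum_def increasing_lists_1)

lemma nested_sum_snoc_Suc:
  assumes "N > 0"
  shows "nested_sum (Suc N) (rs @ [q]) = nested_sum N (rs @ [q]) + nested_sum N rs / real N ^ q"
proof -
  let ?g = "\<lambda>ns. \<Prod>i<length (rs @ [q]). 1 / real (ns ! i) ^ ((rs @ [q]) ! i)"
  have "nested_sum (Suc N) (rs @ [q]) = sum ?g (increasing_lists N (Suc (length rs)) \<union> (\<lambda>ns. ns @ [N]) ` increasing_lists N (length rs))"
    unfolding nested_sum_def by (simp only: increasing_lists_Suc[OF assms] length_append_singleton)
  also have "\<dots> = sum ?g (increasing_lists N (Suc (length rs))) + sum ?g ((\<lambda>ns. ns @ [N]) ` increasing_lists N (length rs))"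
    by (rule sum.union_disjoint) (auto intro!: finite_increasing_lists, auto simp: increasing_lists_def)
  also have "sum ?g ((\<lambda>ns. ns @ [N]) ` increasing_lists N (length rs)) = sum (\<lambda>ns. ?g (ns @ [N])) (increasing_lists N (length rs))"
    by (subst sum.reindex) (auto simp: inj_on_def)
  also have "\<dots> = (\<Sum>ns\<in>increasing_lists N (length rs). (\<Prod>i<length rs. 1 / real (ns ! i) ^ (rs ! i)) * (1 / real N ^ q))"
    by (intro sum.cong refl prod_snoc) (simp add: increasing_lists_def)
  also have "\<dots> = nested_sum N rs / real N ^ q"
    by (simp add: nested_sum_def sum_divide_distrib)
  finally show ?thesis by (simp add: nested_sum_def)
qed

lemma nested_sum_nonneg: "nested_sum N rs \<ge> 0"
  unfolding nested_sum_def by (intro sum_nonneg prod_nonneg) auto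

section \<open>Compositions into 1 and 2, and the squared product\<close>

lemma finite_compositions12: "finite (compositions12 r)"
proof (rule finite_subset)
  have "length rs \<le> sum_list rs" if "set rs \<subseteq> {1, 2}" for rs :: "nat list"
    using that by (induction rs) auto
  then show "compositions12 r \<subseteq> {rs. set rs \<subseteq> {1, 2} \<and> length rs \<le> r}"
    by (auto simp: compositions12_def)
qed (simp add: finite_lists_length_le)

lemma compositions12_0: "compositions12 0 = {[]}"
proof -
  have "rs = []" if "set rs \<subseteq> {1, 2}" "sum_list rs = 0" for rs :: "nat list"
    using that by (cases rs) auto
  then show ?thesis by (auto simp: compositions12_def)
qed

text \<open>Split off the last part. The case \<open>r = 0\<close> is separate because
  \<open>r - 1\<close> truncates to 0 there and would admit \<open>[2]\<close>, whose sum is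
  2.\<close>

lemma compositions12_Suc:
  "compositions12 (Suc r) = (\<lambda>rs. rs @ [1]) ` compositions12 r \<union> 
     (if r = 0 then {} else (\<lambda>rs. rs @ [2]) ` compositions12 (r - 1))"
proof (intro equalityI subsetI)
  fix rs assume rs: "rs \<in> compositions12 (Suc r)"
  then obtain ms x where m: "rs = ms @ [x]"
    by (cases rs rule: rev_cases) (auto simp: compositions12_def)
  then have "x = 1 \<or> x = 2" using rs by (auto simp: compositions12_def)
  then show "rs \<in> (\<lambda>rs. rs @ [1]) ` compositions12 r \<union> 
     (if r = 0 then {} else (\<lambda>rs. rs @ [2]) ` compositions12 (r - 1))"
    using rs by (auto simp: compositions12_def m)
qed (auto simp: compositions12_def split: if_splits)

lemma sum_compositions12_Suc:
  fixes g :: "nat list \<Rightarrow> real"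
  shows "(\<Sum>rs\<in>compositions12 (Suc r). 2 ^ count_list rs 1 * g rs) =
    2 * (\<Sum>rs\<in>compositions12 r. 2 ^ count_list rs 1 * g (rs @ [1])) +
    (if r = 0 then 0 else \<Sum>rs\<in>compositions12 (r - 1). 2 ^ count_list rs 1 * g (rs @ [2]))"
proof -
  have 1: "(\<Sum>rs\<in>(\<lambda>rs. rs @ [1]) ` compositions12 r. 2 ^ count_list rs 1 * g rs) =
      2 * (\<Sum>rs\<in>compositions12 r. 2 ^ count_list rs 1 * g (rs @ [1]))"
    by (subst sum.reindex) (auto simp: inj_on_def sum_distrib_left mult_ac)
  have 2: "(\<Sum>rs\<in>(\<lambda>rs. rs @ [2]) ` A. 2 ^ count_list rs 1 * g rs) =
      (\<Sum>rs\<in>A. 2 ^ count_list rs 1 * g (rs @ [2]))" for A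
    by (subst sum.reindex) (auto simp: inj_on_def)
  show ?thesis
    unfolding compositions12_Suc
    by (subst sum.union_disjoint) (use 1 2 in \<open>auto intro: finite_compositions12\<close>)
qed

lemma sq_coeff_nonneg: "sq_coeff N r \<ge> 0"
  unfolding sq_coeff_def by (intro sum_nonneg mult_nonneg_nonneg nested_sum_nonneg) auto

lemma sq_coeff_0: "sq_coeff N 0 = 1"
  by (simp add: sq_coeff_def compositions12_0)

lemma sq_coeff_1: "sq_coeff (Suc 0) (Suc r) = 0"
  unfolding sq_coeff_def sum_compositions12_Suc nested_sum_snoc_1 by simp

lemma sq_coeff_Suc:
  assumes "N > 0"
  shows "sq_coeff (Suc N) (Suc r) = sq_coeff N (Suc r) + 2 * sq_coeff N r / real N +
    (if r = 0 then 0 else sq_coeff N (r - 1) / real N ^ 2)"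
  unfolding sq_coeff_def sum_compositions12_Suc nested_sum_snoc_Suc[OF assms]
  by (simp add: sum.distrib sum_divide_distrib sum_distrib_left algebra_simps)

text \<open>The field is left general: real arguments yield the coefficient bounds, complex ones the
  series itself.\<close>

lemma sums_sq_coeff:
  fixes y :: "'a :: {real_normed_field}"
  assumes "N > 0"
  shows "(\<lambda>r. of_real (sq_coeff N r) * y ^ r) sums (\<Prod>n\<in>{0<..<N}. (1 + y / of_nat n)\<^sup>2)"
  using assms
proof (induction N rule: nat_induct_non_zero)
  case 1
  have "of_real (sq_coeff 1 r) * y ^ r = (if r = 0 then 1 else 0)" for r
    by (cases r) (auto simp: sq_coeff_0 sq_coeff_1)
  then show ?case using sums_single[of 0 "\<lambda>_. 1 :: 'a"] by (simp add: greaterThanLessThan_eq atLeastLessThan_def greaterThan_def lessThan_def)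
next
  case (Suc N)
  define f where "f r = of_real (sq_coeff N r) * y ^ r" for r
  define S where "S = (\<Prod>n\<in>{0<..<N}. (1 + y / of_nat n)\<^sup>2)"
  have f: "f sums S" using Suc by (simp add: f_def[abs_def] S_def)
  \<comment> \<open>\<open>sh\<close> moves a series by one index and keeps its sum. The power of
    \<open>y\<close> that belongs to the shift sits in the coefficient in front.\<close>
  define sh where "sh g r = (if r = 0 then 0 else g (r - 1))" for g :: "nat \<Rightarrow> 'a" and r
  have sh: "sh g sums s" if "g sums s" for g s
  proof -
    have "(\<lambda>r. sh g (Suc r)) sums s" using that by (simp add: sh_def)
    then show ?thesis by (subst (asm) sums_Suc_iff) (simp add: sh_def)
  qed
  have "(\<lambda>r. f r + (2 * y / of_nat N) * sh f r + (y\<^sup>2 / of_nat N ^ 2) * sh (sh f) r) sums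
     (S + (2 * y / of_nat N) * S + (y\<^sup>2 / of_nat N ^ 2) * S)"
    by (intro sums_add sums_mult sh f)
  also have "(\<lambda>r. f r + (2 * y / of_nat N) * sh f r + (y\<^sup>2 / of_nat N ^ 2) * sh (sh f) r) =
     (\<lambda>r. of_real (sq_coeff (Suc N) r) * y ^ r)"
  proof
    fix r
    show "f r + (2 * y / of_nat N) * sh f r + (y\<^sup>2 / of_nat N ^ 2) * sh (sh f) r = of_real (sq_coeff (Suc N) r) * y ^ r"
    proof (cases r)
      case 0
      then show ?thesis by (simp add: sh_def f_def sq_coeff_0)
    next
      case (Suc q)
      then show ?thesis using \<open>N > 0\<close>
        by (cases q) (auto simp: sh_def f_def sq_coeff_Suc algebra_simps power2_eq_square)
    qed
  qed
  also have "S + (2 * y / of_nat N) * S + (y\<^sup>2 / of_nat N ^ 2) * S = (1 + y / of_nat N)\<^sup>2 * S"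
    by (simp add: power2_eq_square algebra_simps)
  also have "\<dots> = (\<Prod>n\<in>{0<..<Suc N}. (1 + y / of_nat n)\<^sup>2)"
  proof -
    have "{0<..<Suc N} = insert N {0<..<N}" using \<open>N > 0\<close> by auto
    then show ?thesis by (simp add: S_def)
  qed
  finally show ?case .
qed

section \<open>Growth of the coefficients\<close>

text \<open>For \<open>y \<le> 1/3\<close> each factor is at most \<open>1 + 1/n\<close>, and the
  product of these telescopes to \<open>N\<close>.\<close>

lemma prod_square_le:
  assumes "N > 0" "0 \<le> y" "y \<le> 1/3"
  shows "(\<Prod>n\<in>{0<..<N}. (1 + y / real n)\<^sup>2) \<le> real N"
  using assms(1)
proof (induction N rule: nat_induct_non_zero)
  case 1
  have "{0<..<Suc 0} = {}" by auto
  then show ?case by simp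
next
  case (Suc N)
  have "{0<..<Suc N} = insert N {0<..<N}" using \<open>N > 0\<close> by auto
  then have "(\<Prod>n\<in>{0<..<Suc N}. (1 + y / real n)\<^sup>2) = (1 + y / real N)\<^sup>2 * (\<Prod>n\<in>{0<..<N}. (1 + y / real n)\<^sup>2)"
    by simp
  also have "\<dots> \<le> (1 + 1 / real N) * real N"
  proof (intro mult_mono Suc)
    have "(1 + y / real N)\<^sup>2 \<le> (1 + (1/3) / real N)\<^sup>2"
      using assms by (intro power_mono add_left_mono divide_right_mono) auto
    also have "\<dots> \<le> 1 + 1 / real N"
      using \<open>N > 0\<close> by (simp add: power2_eq_square field_simps)
    finally show "(1 + y / real N)\<^sup>2 \<le> 1 + 1 / real N" .
  qed (auto intro!: prod_nonneg)
  also have "\<dots> = real (Suc N)" using \<open>N > 0\<close> by (simp add: field_simps)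
  finally show ?case .
qed

text \<open>The coefficients are nonnegative, so each term of the power series at
  \<open>y = 1/3\<close> is at most the whole sum.\<close>

lemma sq_coeff_le:
  assumes "N > 0"
  shows "sq_coeff N r \<le> 3 ^ r * real N"
proof -
  have s: "(\<lambda>r. sq_coeff N r * (1/3) ^ r) sums (\<Prod>n\<in>{0<..<N}. (1 + (1/3) / real n)\<^sup>2)"
    using sums_sq_coeff[OF assms, of "1/3 :: real"] by simp
  have "sq_coeff N r * (1/3) ^ r = (\<Sum>i\<in>{r}. sq_coeff N i * (1/3) ^ i)" by simp
  also have "\<dots> \<le> (\<Prod>n\<in>{0<..<N}. (1 + (1/3) / real n)\<^sup>2)"
    unfolding sums_unique[OF s] by (rule sum_le_suminf) (use s sq_coeff_nonneg in \<open>auto simp: sums_iff\<close>)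
  also have "\<dots> \<le> real N" by (rule prod_square_le) (use assms in auto)
  finally show ?thesis by (simp add: field_simps)
qed

lemma nested_sum_le_sq_coeff:
  assumes "rs \<in> compositions12 r"
  shows "nested_sum N rs \<le> sq_coeff N r"
proof -
  have "1 * nested_sum N rs \<le> 2 ^ count_list rs 1 * nested_sum N rs"
    by (intro mult_right_mono nested_sum_nonneg) auto
  also have "\<dots> \<le> sq_coeff N r"
    unfolding sq_coeff_def using assms nested_sum_nonneg
    by (intro member_le_sum finite_compositions12) auto
  finally show ?thesis by simp
qed

section \<open>Multiple zeta values as series over the largest index\<close>

lemma summable_on_inverse_square: "(\<lambda>N. 1 / real N ^ 2) summable_on {0<..}"
proof -
  have "summable (\<lambda>n. norm (1 / real n ^ 2))"
    using inverse_power_summable[of 2, where 'a = real] by (simp add: field_simps)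
  then have "(\<lambda>N. 1 / real N ^ 2) summable_on UNIV"
    by (rule norm_summable_imp_summable_on)
  then show ?thesis by (rule summable_on_subset) auto
qed

text \<open>An index list corresponds to the pair of its last entry \<open>N\<close> and the rest.
  The bound \<open>nested_sum N rs \<le> 3 ^ r * N\<close> costs one power of \<open>N\<close>, so
  \<open>k \<ge> 3\<close> gives a majorant of order \<open>1 / N^2\<close>. The weights in
  \<open>\<gamma>\<close> satisfy this: \<open>r \<le> n - k - 1\<close> gives
  \<open>k + n - r \<ge> 2 k + 1\<close>.\<close>

lemma has_sum_mzv:
  assumes rs: "rs \<in> compositions12 r" and k: "k \<ge> 3"
  shows "((\<lambda>N. nested_sum N rs / real N ^ k) has_sum mzv (rs @ [k])) {0<..}"
proof -
  define g where "g ns = (\<Prod>i<length (rs @ [k]). 1 / real (ns ! i) ^ ((rs @ [k]) ! i))" for ns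
  define MS where "MS = {ns :: nat list. length ns = length (rs @ [k]) \<and> sorted_wrt (<) ns \<and> (\<forall>n\<in>set ns. 0 < n)}"
  define SG where "SG = Sigma {0<..} (\<lambda>N. increasing_lists N (length rs))"
  have inner: "((\<lambda>ns. g (ns @ [N])) has_sum (nested_sum N rs / real N ^ k)) (increasing_lists N (length rs))" for N
  proof -
    have "(\<Sum>ns\<in>increasing_lists N (length rs). g (ns @ [N])) = (\<Sum>ns\<in>increasing_lists N (length rs). (\<Prod>i<length rs. 1 / real (ns ! i) ^ (rs ! i)) * (1 / real N ^ k))"
      unfolding g_def by (intro sum.cong refl prod_snoc) (simp add: increasing_lists_def)
    also have "\<dots> = nested_sum N rs / real N ^ k"
      by (simp add: nested_sum_def sum_divide_distrib)
    finally show ?thesis using has_sum_finite[OF finite_increasing_lists] by metis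
  qed
  have outer: "(\<lambda>N. nested_sum N rs / real N ^ k) summable_on {0<..}"
  proof (rule summable_on_comparison_test)
    show "(\<lambda>N. 3 ^ r * (1 / real N ^ 2)) summable_on {0<..}"
      by (intro summable_on_cmult_right summable_on_inverse_square)
    fix N :: nat assume N: "N \<in> {0<..}"
    have "nested_sum N rs \<le> 3 ^ r * real N"
      using nested_sum_le_sq_coeff[OF rs, of N] sq_coeff_le[of N r] N by auto
    moreover have "real N ^ 3 \<le> real N ^ k" using k N by (intro power_increasing) auto
    ultimately have "nested_sum N rs / real N ^ k \<le> 3 ^ r * real N / real N ^ 3"
      using N by (intro frac_le) auto
    also have "\<dots> = 3 ^ r * (1 / real N ^ 2)"
      using N by (simp add: power2_eq_square power3_eq_cube)
    finally show "nested_sum N rs / real N ^ k \<le> 3 ^ r * (1 / real N ^ 2)" .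
    show "0 \<le> nested_sum N rs / real N ^ k" using nested_sum_nonneg by simp
  qed
  have g0: "g ns \<ge> 0" for ns
    unfolding g_def by (rule prod_nonneg) auto
  have s: "(\<lambda>(N, ns). g (ns @ [N])) summable_on SG"
    unfolding SG_def
    by (rule summable_on_SigmaI[where g = "\<lambda>N. nested_sum N rs / real N ^ k"])
      (use inner outer g0 in auto)
  have "((\<lambda>(N, ns). g (ns @ [N])) has_sum (mzv (rs @ [k]))) SG"
  proof -
    have "infsum g MS = infsum (\<lambda>(N, ns). g (ns @ [N])) SG"
    proof (rule infsum_reindex_bij_witness[where i = "\<lambda>(N, ns). ns @ [N]" and j = "\<lambda>ns. (last ns, butlast ns)"])
      fix ns assume ns: "ns \<in> MS"
      then obtain ms x where m: "ns = ms @ [x]"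
        by (cases ns rule: rev_cases) (auto simp: MS_def)
      show "(case (last ns, butlast ns) of (N, ns) \<Rightarrow> ns @ [N]) = ns" using m by simp
      show "(last ns, butlast ns) \<in> SG" using ns m by (auto simp: MS_def SG_def increasing_lists_def sorted_wrt_append)
      show "(case (last ns, butlast ns) of (N, ns) \<Rightarrow> g (ns @ [N])) = g ns" using m by simp
    next
      fix b assume b: "b \<in> SG"
      then show "(last (case b of (N, ns) \<Rightarrow> ns @ [N]), butlast (case b of (N, ns) \<Rightarrow> ns @ [N])) = b" by (cases b) auto
      show "(case b of (N, ns) \<Rightarrow> ns @ [N]) \<in> MS"
        using b by (auto simp: MS_def SG_def increasing_lists_def sorted_wrt_append subset_eq)
    qed
    moreover have "mzv (rs @ [k]) = infsum g MS" by (simp only: mzv_def g_def[abs_def] MS_def)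
    ultimately show ?thesis using has_sum_infsum[OF s] by simp
  qed
  then show ?thesis unfolding SG_def
    by (rule has_sum_SigmaD) (use inner in auto)
qed

lemma has_sum_sum_finite:
  fixes f :: "'a \<Rightarrow> 'b \<Rightarrow> 'c :: topological_comm_monoid_add"
  assumes "finite I" "\<And>i. i \<in> I \<Longrightarrow> (f i has_sum s i) A"
  shows "((\<lambda>x. \<Sum>i\<in>I. f i x) has_sum (\<Sum>i\<in>I. s i)) A"
  using assms by (induction I rule: finite_induct) (auto intro: has_sum_add)

lemma has_sum_Z:
  assumes "k \<ge> 3"
  shows "((\<lambda>N. sq_coeff N r / real N ^ k) has_sum Z k r) {0<..}"
proof -
  have "((\<lambda>N. \<Sum>rs\<in>compositions12 r. 2 ^ count_list rs 1 * (nested_sum N rs / real N ^ k)) has_sum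
     (\<Sum>rs\<in>compositions12 r. 2 ^ count_list rs 1 * mzv (rs @ [k]))) {0<..}"
    by (intro has_sum_sum_finite finite_compositions12 has_sum_cmult_right has_sum_mzv assms)
  then show ?thesis
    by (simp add: Z_def sq_coeff_def compositions12_def sum_divide_distrib)
qed

section \<open>Rearrangement of the double series\<close>

lemma has_sum_product:
  fixes f :: "'a \<Rightarrow> 'c :: {real_normed_field, banach}" and g :: "'b \<Rightarrow> 'c"
  assumes "(f has_sum s) A" "(g has_sum t) B" "f abs_summable_on A" "g abs_summable_on B"
  shows "((\<lambda>(x, y). f x * g y) has_sum s * t) (A \<times> B)"
proof -
  have "(\<lambda>p. norm (f (fst p) * g (snd p))) summable_on A \<times> B"
  proof (rule summable_on_SigmaI)
    show "((\<lambda>y. norm (f (fst (x, y)) * g (snd (x, y)))) has_sum norm (f x) * infsum (\<lambda>y. norm (g y)) B) B" for x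
      using assms(4) by (auto simp: norm_mult intro!: has_sum_cmult_right)
    show "(\<lambda>x. norm (f x) * infsum (\<lambda>y. norm (g y)) B) summable_on A"
      using assms(3) by (rule summable_on_cmult_left)
  qed auto
  then have "(\<lambda>p. f (fst p) * g (snd p)) summable_on A \<times> B"
    by (rule abs_summable_summable)
  then have s: "(\<lambda>(x, y). f x * g y) summable_on A \<times> B"
    by (simp add: case_prod_unfold)
  show ?thesis
    by (rule has_sum_SigmaI[where g = "\<lambda>x. f x * t", OF _ _ s])
      (use assms in \<open>auto intro: has_sum_cmult_right has_sum_cmult_left\<close>)
qed

section \<open>The even part of a geometric series\<close>

text \<open>Expand each \<open>(x + y) ^ q\<close>. The same expansion at the norms gives absolute
  convergence, hence the condition on \<open>norm x + norm y\<close> instead of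
  \<open>norm (x + y)\<close>.\<close>

lemma has_sum_binomial_geometric:
  fixes x y :: "'c :: {real_normed_field, banach}"
  assumes "norm x + norm y < 1"
  shows "((\<lambda>(q, i). of_nat (q choose i) * x ^ (q - i) * y ^ i) has_sum (1 / (1 - (x + y)))) (Sigma UNIV (\<lambda>q. {..q}))"
    and "(\<lambda>(q, i). of_nat (q choose i) * x ^ (q - i) * y ^ i) abs_summable_on Sigma UNIV (\<lambda>q. {..q})"
proof -
  \<comment> \<open>Stated for an arbitrary field, since it is applied to \<open>x\<close>,
    \<open>y\<close> and to their real norms; likewise \<open>geo\<close>.\<close>
  have bin: "((\<lambda>i. of_nat (q choose i) * x ^ (q - i) * y ^ i) has_sum (x + y) ^ q) {..q}"
    for x y :: "'d :: {real_normed_field, banach}" and q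
    by (rule has_sum_finiteI) (simp_all add: binomial_ring[of y x q, unfolded add.commute[of y x]] mult_ac)
  have geo: "((\<lambda>q. z ^ q) has_sum (1 / (1 - z))) UNIV" if "norm z < 1" for z :: "'d :: {real_normed_field, banach}"
    by (rule norm_summable_imp_has_sum) (use that in \<open>auto simp: norm_power intro: summable_geometric geometric_sums\<close>)
  have "(\<lambda>p. norm (of_nat (fst p choose snd p) * x ^ (fst p - snd p) * y ^ snd p)) summable_on Sigma UNIV (\<lambda>q. {..q})"
  proof (rule summable_on_SigmaI)
    show "((\<lambda>i. norm (of_nat (fst (q, i) choose snd (q, i)) * x ^ (fst (q, i) - snd (q, i)) * y ^ snd (q, i))) has_sum (norm x + norm y) ^ q) {..q}" for q
      using bin[of q "norm x" "norm y"] by (simp add: norm_mult norm_power)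
    show "(\<lambda>q. (norm x + norm y) ^ q) summable_on UNIV"
      using geo[of "norm x + norm y"] assms by (auto simp: summable_on_def)
  qed auto
  then show ab: "(\<lambda>(q, i). of_nat (q choose i) * x ^ (q - i) * y ^ i) abs_summable_on Sigma UNIV (\<lambda>q. {..q})"
    by (simp add: case_prod_unfold)
  show "((\<lambda>(q, i). of_nat (q choose i) * x ^ (q - i) * y ^ i) has_sum (1 / (1 - (x + y)))) (Sigma UNIV (\<lambda>q. {..q}))"
  proof (rule has_sum_SigmaI[OF _ _ abs_summable_summable[OF ab]])
    show "((\<lambda>i. case (q, i) of (q, i) \<Rightarrow> of_nat (q choose i) * x ^ (q - i) * y ^ i) has_sum (x + y) ^ q) {..q}" for q
      using bin by simp
    show "((\<lambda>q. (x + y) ^ q) has_sum (1 / (1 - (x + y)))) UNIV"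
      using norm_triangle_ineq[of x y] assms by (intro geo) auto
  qed
qed

text \<open>Averaging the series at \<open>y\<close> and \<open>- y\<close> removes the odd powers
  of \<open>y\<close>; the index is then \<open>q = m + 2 j\<close>, \<open>i = 2 j\<close>.\<close>

lemma has_sum_even_binomial:
  fixes x y :: "'c :: {real_normed_field, banach}"
  assumes "norm x + norm y < 1"
  shows "((\<lambda>(m, j). of_nat ((m + 2 * j) choose (2 * j)) * x ^ m * y ^ (2 * j)) has_sum ((1 - x) / ((1 - x)\<^sup>2 - y\<^sup>2))) UNIV"
proof -
  define D where "D = Sigma (UNIV :: nat set) (\<lambda>q. {..q})"
  define E where "E = {p \<in> D. even (snd p)}"
  define g where "g = (\<lambda>(q, i). of_nat (q choose i) * x ^ (q - i) * y ^ i)"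
  have "((\<lambda>p. (g p + (\<lambda>(q, i). of_nat (q choose i) * x ^ (q - i) * (- y) ^ i) p) * (1/2)) has_sum
      (1 / (1 - (x + y)) + 1 / (1 - (x + (- y)))) * (1/2)) D"
    unfolding g_def D_def
    by (intro has_sum_cmult_left has_sum_add has_sum_binomial_geometric) (use assms in auto)
  also have "(1 / (1 - (x + y)) + 1 / (1 - (x + (- y)))) * (1/2) = (1 - x) / ((1 - x)\<^sup>2 - y\<^sup>2)"
  proof -
    have "norm (x + y) < 1" "norm (x - y) < 1"
      using norm_triangle_ineq[of x y] norm_triangle_ineq4[of x y] assms by auto
    then have "x + y \<noteq> 1" "x - y \<noteq> 1" by auto
    then have nz: "1 - x - y \<noteq> 0" "1 - x + y \<noteq> 0" by (auto simp: algebra_simps)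
    have sq: "(1 - x)\<^sup>2 - y\<^sup>2 = (1 - x - y) * (1 - x + y)"
      by (simp add: power2_eq_square algebra_simps)
    have "1 / (1 - (x + y)) + 1 / (1 - (x + (- y))) = (2 * (1 - x)) / ((1 - x - y) * (1 - x + y))"
      using nz by (simp add: divide_simps) (simp add: algebra_simps)
    moreover have "(2 * w) / D * (1/2) = w / D" for w D :: 'c by simp
    ultimately show ?thesis unfolding sq by (simp only:)
  qed
  finally have "((\<lambda>p. (g p + (\<lambda>(q, i). of_nat (q choose i) * x ^ (q - i) * (- y) ^ i) p) * (1/2)) has_sum
     ((1 - x) / ((1 - x)\<^sup>2 - y\<^sup>2))) D" .
  also have "?this \<longleftrightarrow> (g has_sum ((1 - x) / ((1 - x)\<^sup>2 - y\<^sup>2))) E"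
    by (rule has_sum_cong_neutral) (auto simp: E_def D_def g_def)
  also have "\<dots> \<longleftrightarrow> ((\<lambda>(m, j). of_nat ((m + 2 * j) choose (2 * j)) * x ^ m * y ^ (2 * j)) has_sum ((1 - x) / ((1 - x)\<^sup>2 - y\<^sup>2))) UNIV"
    by (rule has_sum_reindex_bij_witness[where i = "\<lambda>(m, j). (m + 2 * j, 2 * j)" and j = "\<lambda>(q, i). (q - i, i div 2)"])
      (auto simp: E_def D_def g_def)
  finally show ?thesis .
qed

text \<open>
  The index \<open>(r, m, j)\<close> stands for the \<open>r\<close>-th term of \<open>\<gamma> n k\<close> with \<open>n - k - 1 = m + r\<close> and \<open>k = j + 1\<close>.
\<close>

definition triple_term :: "'c :: real_normed_field \<Rightarrow> 'c \<Rightarrow> 'c \<Rightarrow> nat \<Rightarrow> nat \<times> nat \<times> nat \<Rightarrow> 'c" where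
  "triple_term u x y N = (\<lambda>(r, m, j). of_real (sq_coeff N r) * u ^ r *
     (of_nat ((m + 2 * j) choose (2 * j)) * x ^ m * y ^ (2 * j)) / of_nat N ^ (m + 2 * j + 3))"

section \<open>Absolute convergence over \<open>N\<close>, \<open>r\<close>, \<open>m\<close>,
  \<open>j\<close> and exchange of the order\<close>

text \<open>As \<open>sq_coeff\<close> is nonnegative, norms only replace the arguments by their
  norms. Absolute convergence thus follows from the closed form below, taken over the reals.\<close>

lemma norm_triple_term: "norm (triple_term u x y N z) = triple_term (norm u) (norm x) (norm y) N z"
  by (cases z) (simp add: triple_term_def norm_mult norm_divide norm_power sq_coeff_nonneg)

text \<open>For fixed \<open>N\<close> the sum factors into the power series in \<open>u\<close> and
  the even binomial series at \<open>x / N\<close>, \<open>y / N\<close>, with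
  \<open>1 / N^3\<close> left over.\<close>

lemma has_sum_triple_term:
  fixes u x y :: "'c :: {real_normed_field, banach}"
  assumes N: "N > 0" and xy: "norm x + norm y < 1"
  shows "(triple_term u x y N has_sum (\<Prod>n\<in>{0<..<N}. (1 + u / of_nat n)\<^sup>2) *
     ((1 - x / of_nat N) / ((1 - x / of_nat N)\<^sup>2 - (y / of_nat N)\<^sup>2)) / of_nat N ^ 3) UNIV"
proof -
  let ?x = "x / of_nat N" and ?y = "y / of_nat N"
  let ?g = "\<lambda>x y (m, j). of_nat ((m + 2 * j) choose (2 * j)) * x ^ m * y ^ (2 * j)"
  have "norm ?x + norm ?y = (norm x + norm y) / real N"
    by (simp add: norm_divide add_divide_distrib)
  also have "\<dots> < 1" using N xy by (simp add: divide_less_eq)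
  finally have 1: "norm ?x + norm ?y < 1" .
  have "(\<lambda>p. norm (?g ?x ?y p)) = ?g (norm ?x) (norm ?y)"
    by (auto simp: norm_mult norm_power)
  then have g_abs: "?g ?x ?y abs_summable_on UNIV"
    using has_sum_even_binomial[of "norm ?x" "norm ?y"] 1 by (auto simp: summable_on_def)
  let ?f = "\<lambda>r. of_real (sq_coeff N r) * u ^ r"
  have "summable (\<lambda>r. norm (?f r))"
    using sums_sq_coeff[OF N, of "norm u"] 
    by (auto simp: norm_mult norm_power sq_coeff_nonneg sums_iff)
  then have f: "(?f has_sum (\<Prod>n\<in>{0<..<N}. (1 + u / of_nat n)\<^sup>2)) UNIV" "?f abs_summable_on UNIV"
    using norm_summable_imp_has_sum[OF _ sums_sq_coeff[OF N, of u]] norm_summable_imp_summable_on[of "\<lambda>r. norm (?f r)"] by auto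
  have "((\<lambda>(r, p). ?f r * ?g ?x ?y p) has_sum
     ((\<Prod>n\<in>{0<..<N}. (1 + u / of_nat n)\<^sup>2) * ((1 - ?x) / ((1 - ?x)\<^sup>2 - ?y\<^sup>2)))) (UNIV \<times> UNIV)"
    by (intro has_sum_product f g_abs has_sum_even_binomial[OF 1])
  then have "((\<lambda>z. (\<lambda>(r, p). ?f r * ?g ?x ?y p) z * (1 / of_nat N ^ 3)) has_sum
     ((\<Prod>n\<in>{0<..<N}. (1 + u / of_nat n)\<^sup>2) * ((1 - ?x) / ((1 - ?x)\<^sup>2 - ?y\<^sup>2))) * (1 / of_nat N ^ 3)) (UNIV \<times> UNIV)"
    by (rule has_sum_cmult_left)
  moreover have "(\<lambda>z. (\<lambda>(r, p). ?f r * ?g ?x ?y p) z * (1 / of_nat N ^ 3)) = triple_term u x y N"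
    by (auto simp: triple_term_def power_divide power_add)
  ultimately show ?thesis by simp
qed

lemma triple_sum_le:
  fixes u x y :: real
  assumes N: "N > 0" and u: "0 \<le> u" "u \<le> 1/3" and x: "0 \<le> x" "x \<le> 1/4" and y: "0 \<le> y" "y \<le> 1/4"
  shows "(\<Prod>n\<in>{0<..<N}. (1 + u / of_nat n)\<^sup>2) *
     ((1 - x / of_nat N) / ((1 - x / of_nat N)\<^sup>2 - (y / of_nat N)\<^sup>2)) / of_nat N ^ 3 \<le> 2 * (1 / real N ^ 2)"
proof -
  define t where "t = 1 - x / N"
  define s where "s = y / N"
  have "x / N \<le> x" "s \<le> y" using N x y by (simp_all add: s_def divide_le_eq mult_le_cancel_left1)
  then have t: "3/4 \<le> t" and s: "0 \<le> s" "s \<le> 1/4"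
    using x y unfolding t_def s_def by (linarith, simp, linarith)
  \<comment> \<open>From \<open>t \<ge> 3/4\<close> and \<open>s \<le> 1/4\<close>:
    \<open>2 t^2 - 2 s^2 \<ge> 3/2 t - 1/8 \<ge> t\<close>.\<close>
  have "t / (t\<^sup>2 - s\<^sup>2) \<le> 2"
  proof -
    have a: "s * s \<le> 1/4 * (1/4)" using s by (intro mult_mono) auto
    have b: "3/4 * (3/4) \<le> t * t" using t by (intro mult_mono) auto
    have c: "(3/4) * t \<le> t * t" using t by (intro mult_right_mono) auto
    have "t * t - s * s > 0" using a b by linarith
    moreover have "t \<le> 2 * (t * t) - 2 * (s * s)" using a c t by linarith
    then have "t \<le> 2 * (t * t - s * s)" by (simp only: right_diff_distrib)
    ultimately have "t\<^sup>2 - s\<^sup>2 > 0" "t \<le> 2 * (t\<^sup>2 - s\<^sup>2)"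
      unfolding power2_eq_square by blast+
    then show ?thesis by (simp add: divide_le_eq)
  qed
  moreover have "t / (t\<^sup>2 - s\<^sup>2) \<ge> 0"
  proof -
    have "s\<^sup>2 \<le> t\<^sup>2" using s t by (intro power_mono) auto
    then show ?thesis using t by simp
  qed
  ultimately have "(\<Prod>n\<in>{0<..<N}. (1 + u / of_nat n)\<^sup>2) * (t / (t\<^sup>2 - s\<^sup>2)) / real N ^ 3 \<le> real N * 2 / real N ^ 3"
    by (intro divide_right_mono mult_mono prod_square_le N u) auto
  also have "\<dots> = 2 * (1 / real N ^ 2)" using N by (simp add: power2_eq_square power3_eq_cube)
  finally show ?thesis by (simp add: t_def s_def)
qed

lemma triple_term_summable:
  fixes u x y :: complex
  assumes u: "norm u \<le> 1/3" and x: "norm x \<le> 1/4" and y: "norm y \<le> 1/4"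
  shows "(\<lambda>(N, z). triple_term u x y N z) summable_on {0<..} \<times> UNIV"
proof -
  have "(\<lambda>p. norm (triple_term u x y (fst p) (snd p))) summable_on {0<..} \<times> UNIV"
  proof (rule summable_on_SigmaI)
    fix N :: nat assume N: "N \<in> {0<..}"
    show "((\<lambda>z. norm (triple_term u x y (fst (N, z)) (snd (N, z)))) has_sum (\<Prod>n\<in>{0<..<N}. (1 + norm u / of_nat n)\<^sup>2) *
     ((1 - norm x / of_nat N) / ((1 - norm x / of_nat N)\<^sup>2 - (norm y / of_nat N)\<^sup>2)) / of_nat N ^ 3) UNIV"
      unfolding norm_triple_term fst_conv snd_conv
      by (rule has_sum_triple_term) (use N x y in auto)
  next
    show "(\<lambda>N. (\<Prod>n\<in>{0<..<N}. (1 + norm u / of_nat n)\<^sup>2) *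
     ((1 - norm x / of_nat N) / ((1 - norm x / of_nat N)\<^sup>2 - (norm y / of_nat N)\<^sup>2)) / of_nat N ^ 3) summable_on {0<..}"
    proof (rule summable_on_comparison_test)
      show "(\<lambda>N. 2 * (1 / real N ^ 2)) summable_on {0<..}"
        by (intro summable_on_cmult_right summable_on_inverse_square)
      fix N :: nat assume N: "N \<in> {0<..}"
      show "(\<Prod>n\<in>{0<..<N}. (1 + norm u / of_nat n)\<^sup>2) *
     ((1 - norm x / of_nat N) / ((1 - norm x / of_nat N)\<^sup>2 - (norm y / of_nat N)\<^sup>2)) / of_nat N ^ 3 \<le> 2 * (1 / real N ^ 2)"
        by (rule triple_sum_le) (use N u x y in auto)
      have "(triple_term (norm u) (norm x) (norm y) N has_sum ((\<Prod>n\<in>{0<..<N}. (1 + norm u / of_nat n)\<^sup>2) *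
     ((1 - norm x / of_nat N) / ((1 - norm x / of_nat N)\<^sup>2 - (norm y / of_nat N)\<^sup>2)) / of_nat N ^ 3)) UNIV"
        by (rule has_sum_triple_term) (use N x y in auto)
      then show "0 \<le> (\<Prod>n\<in>{0<..<N}. (1 + norm u / of_nat n)\<^sup>2) *
     ((1 - norm x / of_nat N) / ((1 - norm x / of_nat N)\<^sup>2 - (norm y / of_nat N)\<^sup>2)) / of_nat N ^ 3"
        by (rule has_sum_nonneg) (simp flip: norm_triple_term)
    qed
  qed auto
  then show ?thesis
    using abs_summable_summable[of "\<lambda>(N, z). triple_term u x y N z"] by (simp add: case_prod_unfold)
qed

text \<open>The sum in \<open>has_sum_triple_term\<close> at \<open>u = - 2 * X\<close>,
  \<open>x = X\<close>, \<open>y = Y\<close>. The 4 is what remains of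
  \<open>(- 2) ^ (r + 2)\<close> once \<open>(- 2) ^ r\<close> is absorbed in
  \<open>u ^ r\<close>.\<close>

definition W_summand :: "complex \<Rightarrow> complex \<Rightarrow> nat \<Rightarrow> complex" where
  "W_summand X Y N = 4 * ((\<Prod>n\<in>{0<..<N}. (1 - 2 * X / of_nat n)\<^sup>2) *
     ((1 - X / of_nat N) / ((1 - X / of_nat N)\<^sup>2 - (Y / of_nat N)\<^sup>2)) / of_nat N ^ 3)"

lemma norm_W_summand_le:
  assumes X: "norm X \<le> 1/6" and Y: "norm Y \<le> 1/6" and N: "N > 0"
  shows "norm (W_summand X Y N) \<le> 8 * (1 / real N ^ 2)"
proof -
  define S where "S = (\<Prod>n\<in>{0<..<N}. (1 + (- 2 * X) / of_nat n)\<^sup>2) *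
     ((1 - X / of_nat N) / ((1 - X / of_nat N)\<^sup>2 - (Y / of_nat N)\<^sup>2)) / of_nat N ^ 3"
  define S' where "S' = (\<Prod>n\<in>{0<..<N}. (1 + norm (- 2 * X) / of_nat n)\<^sup>2) *
     ((1 - norm X / of_nat N) / ((1 - norm X / of_nat N)\<^sup>2 - (norm Y / of_nat N)\<^sup>2)) / real N ^ 3"
  have "(triple_term (- 2 * X) X Y N has_sum S) UNIV"
    unfolding S_def by (rule has_sum_triple_term) (use X Y N in auto)
  moreover have "(triple_term (norm (- 2 * X)) (norm X) (norm Y) N has_sum S') UNIV"
    unfolding S'_def by (rule has_sum_triple_term) (use X Y N in auto)
  ultimately have "norm S \<le> S'"
    by (intro norm_has_sum_bound[of "triple_term (- 2 * X) X Y N"]) (simp_all add: norm_triple_term)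
  also have "S' \<le> 2 * (1 / real N ^ 2)"
    unfolding S'_def by (rule triple_sum_le) (use X Y N in \<open>auto simp: norm_mult\<close>)
  finally have "norm S \<le> 2 * (1 / real N ^ 2)" .
  moreover have "W_summand X Y N = 4 * S" by (simp add: W_summand_def S_def)
  ultimately show ?thesis by (simp add: norm_mult)
qed

text \<open>One absolutely convergent sum over \<open>(N, r, m, j)\<close> is evaluated in two
  orders: \<open>r, m, j\<close> first gives \<open>W_summand\<close>, while \<open>N\<close> and
  then the finitely many \<open>r\<close> first gives \<open>W_term\<close>. The bound 1/6 on
  \<open>X\<close> makes \<open>norm (- 2 * X) \<le> 1/3\<close>, as \<open>prod_square_le\<close>
  requires.\<close>

lemma W_term_has_sum:
  assumes X: "norm X \<le> 1/6" and Y: "norm Y \<le> 1/6"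
  obtains S where "(W_term X Y has_sum S) W_idx" "(W_summand X Y has_sum S) {0<..}"
proof -
  define H where "H = (\<lambda>(N, z). 4 * triple_term (- 2 * X) X Y N z)"
  have H: "H summable_on {0<..} \<times> UNIV"
  proof -
    have "(\<lambda>p. 4 * (\<lambda>(N, z). triple_term (- 2 * X) X Y N z) p) summable_on {0<..} \<times> UNIV"
      by (intro summable_on_cmult_right triple_term_summable) (use X Y in \<open>auto simp: norm_mult\<close>)
    then show ?thesis by (simp add: H_def case_prod_unfold)
  qed
  define S where "S = infsum H ({0<..} \<times> UNIV)"
  have HS: "(H has_sum S) ({0<..} \<times> UNIV)" unfolding S_def using H by (rule has_sum_infsum)
  have "(W_summand X Y has_sum S) {0<..}"
  proof (rule has_sum_SigmaD[OF HS])
    fix N :: nat assume N: "N \<in> {0<..}"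
    have "((\<lambda>z. 4 * triple_term (- 2 * X) X Y N z) has_sum 4 * ((\<Prod>n\<in>{0<..<N}. (1 + (- 2 * X) / of_nat n)\<^sup>2) *
     ((1 - X / of_nat N) / ((1 - X / of_nat N)\<^sup>2 - (Y / of_nat N)\<^sup>2)) / of_nat N ^ 3)) UNIV"
      by (intro has_sum_cmult_right has_sum_triple_term) (use X Y N in auto)
    then show "((\<lambda>z. H (N, z)) has_sum W_summand X Y N) UNIV"
      by (simp add: H_def W_summand_def)
  qed
  moreover have "(W_term X Y has_sum S) W_idx"
  proof -
    \<comment> \<open>Regrouping by monomials: \<open>n = m + r + j + 2\<close> and
      \<open>k = j + 1\<close>, so \<open>X\<close> has exponent \<open>m + r = n - k - 1\<close>,
      and \<open>m \<ge> 0\<close> means \<open>r \<le> n - k - 1\<close>.\<close>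
    define B where "B = (\<lambda>(n, k). {0..n - k - 1 :: nat} \<times> {0 :: nat<..})"
    define F where "F = (\<lambda>((n, k), (r, N)). H (N, (r, n - k - 1 - r, k - 1)))"
    have F: "(F has_sum S) (Sigma W_idx B)"
    proof -
      have "(H has_sum S) ({0<..} \<times> UNIV) \<longleftrightarrow> (F has_sum S) (Sigma W_idx B)"
        by (rule has_sum_reindex_bij_witness[where i = "\<lambda>((n, k), (r, N)). (N, (r, n - k - 1 - r, k - 1))" 
             and j = "\<lambda>(N, (r, m, j)). ((m + r + j + 2, j + 1), (r, N))"])
           (auto simp: W_idx_def B_def F_def)
      with HS show ?thesis by simp
    qed
    show ?thesis
    proof (rule has_sum_SigmaD[OF F])
      fix p assume p: "p \<in> W_idx"
      obtain n k where nk: "p = (n, k)" "0 < k" "k < n" using p by (auto simp: W_idx_def)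
      define c where "c r = of_real ((-2) ^ (r + 2) * real ((n - r + k - 3) choose (2 * k - 2)) * Z (k + n - r) r) *
        X ^ (n - k - 1) * Y ^ (2 * k - 2)" for r
      have sF: "(\<lambda>y. F (p, y)) summable_on B p"
      proof (rule summable_on_SigmaD1[OF _ p])
        show "(\<lambda>(x, y). F (x, y)) summable_on Sigma W_idx B"
          using has_sum_imp_summable[OF F] by simp
      qed
      have inner: "((\<lambda>N. F (p, (r, N))) has_sum c r) {0<..}" if r: "r \<in> {0..n - k - 1}" for r
      proof -
        have "((\<lambda>N. of_real ((-2) ^ (r + 2) * real ((n - r + k - 3) choose (2 * k - 2))) * X ^ (n - k - 1) * Y ^ (2 * k - 2) * 
            complex_of_real (sq_coeff N r / real N ^ (k + n - r))) has_sum 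
           (of_real ((-2) ^ (r + 2) * real ((n - r + k - 3) choose (2 * k - 2))) * X ^ (n - k - 1) * Y ^ (2 * k - 2) * complex_of_real (Z (k + n - r) r))) {0<..}"
          by (intro has_sum_cmult_right has_sum_of_real has_sum_Z) (use nk r in auto)
        also have "(of_real ((-2) ^ (r + 2) * real ((n - r + k - 3) choose (2 * k - 2))) * X ^ (n - k - 1) * Y ^ (2 * k - 2) * complex_of_real (Z (k + n - r) r)) = c r"
          by (simp add: c_def)
        also have "(\<lambda>N. of_real ((-2) ^ (r + 2) * real ((n - r + k - 3) choose (2 * k - 2))) * X ^ (n - k - 1) * Y ^ (2 * k - 2) * 
            complex_of_real (sq_coeff N r / real N ^ (k + n - r))) = (\<lambda>N. F (p, (r, N)))"
        proof
          fix N
          \<comment> \<open>These say \<open>2 j = 2 k - 2\<close>,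
            \<open>m + 2 j = n - r + k - 3\<close> and \<open>m + 2 j + 3 = k + n - r\<close>; no
            subtraction truncates, because \<open>0 < k < n\<close> and
            \<open>r \<le> n - k - 1\<close>.\<close>
          have e: "2 * (k - 1) = 2 * k - 2" "n - k - 1 - r + (2 * k - 2) = n - r + k - 3"
            "n - r + k - 3 + 3 = k + n - r" using nk r by auto
          define C where "C = (n - r + k - 3) choose (2 * k - 2)"
          define P where "P = (of_nat N ^ (k + n - r) :: complex)"
          have X': "X ^ (n - k - 1) = X ^ r * X ^ (n - k - 1 - r)"
          proof -
            have "n - k - 1 = r + (n - k - 1 - r)" using r by auto
            then show ?thesis by (metis power_add)
          qed
          have "F (p, (r, N)) = 4 * (of_real (sq_coeff N r) * (- 2 * X) ^ r *
              (of_nat C * X ^ (n - k - 1 - r) * Y ^ (2 * k - 2)) / P)"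
            by (simp only: F_def nk(1) H_def triple_term_def prod.case e C_def P_def)
          also have "\<dots> = of_real ((-2) ^ (r + 2) * real C) * X ^ (n - k - 1) * Y ^ (2 * k - 2) *
              complex_of_real (sq_coeff N r / real N ^ (k + n - r))"
            by (simp only: X' power_mult_distrib) (simp add: P_def)
          finally show "of_real ((-2) ^ (r + 2) * real ((n - r + k - 3) choose (2 * k - 2))) * X ^ (n - k - 1) * Y ^ (2 * k - 2) * 
            complex_of_real (sq_coeff N r / real N ^ (k + n - r)) = F (p, (r, N))"
            by (simp only: C_def)
        qed
        finally show ?thesis .
      qed
      \<comment> \<open>Summing over \<open>N\<close> first leaves the finite sum over
        \<open>r\<close> that defines \<open>\<gamma> n k\<close>.\<close>
      have "(c has_sum infsum (\<lambda>y. F (p, y)) (B p)) {0..n - k - 1}"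
      proof (rule has_sum_SigmaD)
        show "((\<lambda>y. F (p, y)) has_sum infsum (\<lambda>y. F (p, y)) (B p)) (Sigma {0..n - k - 1} (\<lambda>_. {0<..}))"
          using has_sum_infsum[OF sF] by (simp add: B_def nk)
      qed (use inner in auto)
      then have "infsum (\<lambda>y. F (p, y)) (B p) = sum c {0..n - k - 1}"
        using has_sum_finite[of "{0..n - k - 1}" c] has_sum_unique by blast
      also have "\<dots> = W_term X Y p"
        by (simp add: W_term_def nk \<gamma>_def c_def sum_distrib_right)
      finally show "((\<lambda>y. F (p, y)) has_sum W_term X Y p) (B p)"
        using has_sum_infsum[OF sF] by simp
    qed
  qed
  ultimately show thesis using that by blast
qed

section \<open>Series of holomorphic functions of two variables\<close>

lemma holomorphic2_onI:
  assumes "\<And>p. p \<in> S \<Longrightarrow> \<exists>a b. (F has_derivative (\<lambda>h. a * fst h + b * snd h)) (at p within S)"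
  shows "holomorphic2_on F S"
  using assms unfolding holomorphic2_on_def by (simp add: case_prod_unfold)

lemma holomorphic2_onE:
  assumes "holomorphic2_on F S" "p \<in> S"
  obtains a b where "(F has_derivative (\<lambda>h. a * fst h + b * snd h)) (at p within S)"
  using assms unfolding holomorphic2_on_def by (auto simp: case_prod_unfold)

lemma holomorphic2_on_subset:
  assumes "holomorphic2_on F S" "T \<subseteq> S"
  shows "holomorphic2_on F T"
  using assms unfolding holomorphic2_on_def by (meson has_derivative_subset subsetD)

lemma holomorphic2_on_cong:
  assumes "holomorphic2_on F S" "\<And>p. p \<in> S \<Longrightarrow> G p = F p"
  shows "holomorphic2_on G S"
proof (rule holomorphic2_onI)
  fix p assume p: "p \<in> S"
  obtain a b where "(F has_derivative (\<lambda>h. a * fst h + b * snd h)) (at p within S)"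
    by (rule holomorphic2_onE[OF assms(1) p])
  from has_derivative_transform[OF p assms(2) this]
  show "\<exists>a b. (G has_derivative (\<lambda>h. a * fst h + b * snd h)) (at p within S)"
    by blast
qed

lemma holomorphic2_on_const: "holomorphic2_on (\<lambda>p. c) S"
proof (rule holomorphic2_onI)
  show "\<exists>a b. ((\<lambda>p. c) has_derivative (\<lambda>h. a * fst h + b * snd h)) (at p within S)" for p
    by (rule exI[of _ 0], rule exI[of _ 0]) (auto intro!: derivative_eq_intros)
qed

lemma holomorphic2_on_fst: "holomorphic2_on fst S"
proof (rule holomorphic2_onI)
  show "\<exists>a b. (fst has_derivative (\<lambda>h. a * fst h + b * snd h)) (at p within S)" for p :: "complex \<times> complex"
    by (rule exI[of _ 1], rule exI[of _ 0]) (auto intro!: derivative_eq_intros)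
qed

lemma holomorphic2_on_snd: "holomorphic2_on snd S"
proof (rule holomorphic2_onI)
  show "\<exists>a b. (snd has_derivative (\<lambda>h. a * fst h + b * snd h)) (at p within S)" for p :: "complex \<times> complex"
    by (rule exI[of _ 0], rule exI[of _ 1]) (auto intro!: derivative_eq_intros)
qed

lemma holomorphic2_on_add:
  assumes "holomorphic2_on F S" "holomorphic2_on G S"
  shows "holomorphic2_on (\<lambda>p. F p + G p) S"
proof (rule holomorphic2_onI)
  fix p assume p: "p \<in> S"
  obtain a b where 1: "(F has_derivative (\<lambda>h. a * fst h + b * snd h)) (at p within S)"
    by (rule holomorphic2_onE[OF assms(1) p])
  obtain a' b' where 2: "(G has_derivative (\<lambda>h. a' * fst h + b' * snd h)) (at p within S)"
    by (rule holomorphic2_onE[OF assms(2) p])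
  show "\<exists>a b. ((\<lambda>p. F p + G p) has_derivative (\<lambda>h. a * fst h + b * snd h)) (at p within S)"
    by (rule exI[of _ "a + a'"], rule exI[of _ "b + b'"], rule has_derivative_eq_rhs[OF has_derivative_add[OF 1 2]])
      (auto simp: algebra_simps)
qed

lemma holomorphic2_on_mult:
  assumes "holomorphic2_on F S" "holomorphic2_on G S"
  shows "holomorphic2_on (\<lambda>p. F p * G p) S"
proof (rule holomorphic2_onI)
  fix p assume p: "p \<in> S"
  obtain a b where 1: "(F has_derivative (\<lambda>h. a * fst h + b * snd h)) (at p within S)"
    by (rule holomorphic2_onE[OF assms(1) p])
  obtain a' b' where 2: "(G has_derivative (\<lambda>h. a' * fst h + b' * snd h)) (at p within S)"
    by (rule holomorphic2_onE[OF assms(2) p])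
  show "\<exists>a b. ((\<lambda>p. F p * G p) has_derivative (\<lambda>h. a * fst h + b * snd h)) (at p within S)"
    by (rule exI[of _ "F p * a' + a * G p"], rule exI[of _ "F p * b' + b * G p"],
        rule has_derivative_eq_rhs[OF has_derivative_mult[OF 1 2]]) (auto simp: algebra_simps)
qed

lemma holomorphic2_on_inverse:
  assumes "holomorphic2_on F S" "\<And>p. p \<in> S \<Longrightarrow> F p \<noteq> 0"
  shows "holomorphic2_on (\<lambda>p. inverse (F p)) S"
proof (rule holomorphic2_onI)
  fix p assume p: "p \<in> S"
  obtain a b where 1: "(F has_derivative (\<lambda>h. a * fst h + b * snd h)) (at p within S)"
    by (rule holomorphic2_onE[OF assms(1) p])
  show "\<exists>a b. ((\<lambda>p. inverse (F p)) has_derivative (\<lambda>h. a * fst h + b * snd h)) (at p within S)"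
    by (rule exI[of _ "- (inverse (F p) * a * inverse (F p))"], rule exI[of _ "- (inverse (F p) * b * inverse (F p))"],
        rule has_derivative_eq_rhs[OF Deriv.has_derivative_inverse[OF assms(2)[OF p] 1]]) (auto simp: algebra_simps)
qed

lemma holomorphic2_on_prod:
  assumes "\<And>i. i \<in> I \<Longrightarrow> holomorphic2_on (F i) S"
  shows "holomorphic2_on (\<lambda>p. \<Prod>i\<in>I. F i p) S"
  using assms
  by (induction I rule: infinite_finite_induct) (auto intro: holomorphic2_on_const holomorphic2_on_mult)

section \<open>Termwise differentiation\<close>

text \<open>Cauchy's inequality on the circle of radius \<open>R/2\<close> about \<open>w\<close>,
  which stays within distance \<open>3/2 R\<close> of 0.\<close>

lemma norm_field_derivative_le:
  fixes f :: "complex \<Rightarrow> complex"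
  assumes "\<And>z. z \<in> ball 0 (2 * R) \<Longrightarrow> (f has_field_derivative f' z) (at z)"
    and "\<And>z. z \<in> ball 0 (2 * R) \<Longrightarrow> norm (f z) \<le> B" and "w \<in> ball 0 R"
  shows "norm (f' w) \<le> B / (R / 2)"
proof -
  have R: "R > 0" using assms(3) by (auto intro: le_less_trans[OF norm_ge_zero])
  have sub: "cball w (R/2) \<subseteq> ball 0 (2 * R)"
  proof
    fix z assume "z \<in> cball w (R/2)"
    then show "z \<in> ball 0 (2 * R)"
      using assms(3) norm_triangle_ineq[of w "z - w"] R by (simp add: dist_norm norm_minus_commute)
  qed
  have hol: "f holomorphic_on ball 0 (2 * R)"
    using assms(1) by (meson field_differentiable_at_within field_differentiable_def holomorphic_onI)
  have "norm ((deriv ^^ 1) f w) \<le> fact 1 * B / (R / 2) ^ 1"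
  proof (rule Cauchy_inequality)
    show "f holomorphic_on ball w (R/2)" "continuous_on (cball w (R/2)) f"
      using holomorphic_on_subset[OF hol] sub ball_subset_cball[of w "R/2"]
      by (blast intro: holomorphic_on_imp_continuous_on)+
    show "0 < R/2" using R by simp
    show "norm (f x) \<le> B" if "norm (w - x) = R/2" for x
      using that sub by (intro assms(2)) (auto simp: dist_norm)
  qed
  moreover have "deriv f w = f' w"
    using assms(1,3) R by (intro DERIV_imp_deriv) auto
  ultimately show ?thesis by simp
qed

text \<open>Termwise differentiation needs uniform convergence of the derivatives. Cauchy's
  inequality in each variable supplies it on the polydisc of half the radius, with the summable
  majorant \<open>C\<close>.\<close>

lemma holomorphic2_on_suminf:
  fixes f :: "nat \<Rightarrow> complex \<times> complex \<Rightarrow> complex"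
  assumes hol: "\<And>n. holomorphic2_on (f n) (ball 0 (2 * R) \<times> ball 0 (2 * R))"
    and bd: "\<And>n p. p \<in> ball 0 (2 * R) \<times> ball 0 (2 * R) \<Longrightarrow> norm (f n p) \<le> B n"
    and B: "summable B" and R: "R > 0"
  shows "holomorphic2_on (\<lambda>p. \<Sum>n. f n p) (ball 0 R \<times> ball 0 R)"
proof -
  define T where "T = (ball 0 (2 * R) \<times> ball 0 (2 * R) :: (complex \<times> complex) set)"
  define S where "S = (ball 0 R \<times> ball 0 R :: (complex \<times> complex) set)"
  have ST: "S \<subseteq> T" using R by (auto simp: S_def T_def)
  have opT: "open T" by (auto simp: T_def intro: open_Times)
  have "\<exists>a b. (f n has_derivative (\<lambda>h. a * fst h + b * snd h)) (at p)" if pT: "p \<in> T" for n p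
  proof -
    obtain a b where "(f n has_derivative (\<lambda>h. a * fst h + b * snd h)) (at p within T)"
      using holomorphic2_onE[OF hol[of n] pT[unfolded T_def]] unfolding T_def by blast
    then show ?thesis using at_within_open[OF pT opT] by auto
  qed
  \<comment> \<open>Putting membership under the quantifier and pairing the coefficients lets one
    choice function serve all \<open>n\<close> and \<open>p\<close>.\<close>
  then have "\<exists>ab. p \<in> T \<longrightarrow> (f n has_derivative (\<lambda>h. fst ab * fst h + snd ab * snd h)) (at p)" for n p
    by (metis fst_conv snd_conv)
  then have "\<forall>n p. \<exists>ab. p \<in> T \<longrightarrow> (f n has_derivative (\<lambda>h. fst ab * fst h + snd ab * snd h)) (at p)"
    by blast
  then obtain ab' where ab': "\<forall>n p. p \<in> T \<longrightarrow> (f n has_derivative (\<lambda>h. fst (ab' n p) * fst h + snd (ab' n p) * snd h)) (at p)"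
    unfolding choice_iff by (elim exE)
  define a where "a n p = fst (ab' n p)" for n p
  define b where "b n p = snd (ab' n p)" for n p
  have ab: "(f n has_derivative (\<lambda>h. a n p * fst h + b n p * snd h)) (at p)" if "p \<in> T" for n p
    using ab' that unfolding a_def b_def by blast
  define C where "C n = B n / (R / 2)" for n
  have sC: "summable C" unfolding C_def using B by (rule summable_divide)
  have a_le: "norm (a n p) \<le> C n" if pS: "p \<in> S" for n p
  proof -
    obtain x y where p: "p = (x, y)" "x \<in> ball 0 R" "y \<in> ball 0 R" using pS by (auto simp: S_def)
    have "norm ((\<lambda>z. a n (z, y)) x) \<le> B n / (R / 2)"
    proof (rule norm_field_derivative_le[where f = "\<lambda>z. f n (z, y)" and f' = "\<lambda>z. a n (z, y)"])
      fix z :: complex assume z: "z \<in> ball 0 (2 * R)"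
      then have zy: "(z, y) \<in> T" using p R by (auto simp: T_def)
      \<comment> \<open>Along the slice with \<open>y\<close> fixed, the coefficient
        \<open>a\<close> is the ordinary complex derivative.\<close>
      have d: "((\<lambda>z. (z, y)) has_derivative (\<lambda>h. (h, 0))) (at z)"
        by (auto intro!: derivative_eq_intros)
      show "((\<lambda>z. f n (z, y)) has_field_derivative a n (z, y)) (at z)"
        using has_derivative_compose[OF d ab[OF zy, of n]] by (simp add: has_field_derivative_def)
      show "norm (f n (z, y)) \<le> B n" using bd zy by (simp add: T_def)
    qed (use p in auto)
    then show ?thesis by (simp add: p C_def)
  qed
  have b_le: "norm (b n p) \<le> C n" if pS: "p \<in> S" for n p
  proof -
    obtain x y where p: "p = (x, y)" "x \<in> ball 0 R" "y \<in> ball 0 R" using pS by (auto simp: S_def)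
    have "norm ((\<lambda>z. b n (x, z)) y) \<le> B n / (R / 2)"
    proof (rule norm_field_derivative_le[where f = "\<lambda>z. f n (x, z)" and f' = "\<lambda>z. b n (x, z)"])
      fix z :: complex assume z: "z \<in> ball 0 (2 * R)"
      then have zy: "(x, z) \<in> T" using p R by (auto simp: T_def)
      have d: "((\<lambda>z. (x, z)) has_derivative (\<lambda>h. (0, h))) (at z)"
        by (auto intro!: derivative_eq_intros)
      show "((\<lambda>z. f n (x, z)) has_field_derivative b n (x, z)) (at z)"
        using has_derivative_compose[OF d ab[OF zy, of n]] by (simp add: has_field_derivative_def)
      show "norm (f n (x, z)) \<le> B n" using bd zy by (simp add: T_def)
    qed (use p in auto)
    then show ?thesis by (simp add: p C_def)
  qed
  have tail: "norm ((\<Sum>i<n. g i) - (\<Sum>i. g i)) \<le> (\<Sum>i. C (i + n))" and sg: "summable g"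
    if g: "\<And>i. norm (g i) \<le> C i" for g :: "nat \<Rightarrow> complex" and n
  proof -
    show s: "summable g" by (rule summable_comparison_test'[OF sC]) (use g in auto)
    have "norm ((\<Sum>i<n. g i) - (\<Sum>i. g i)) = norm (\<Sum>i. g (i + n))"
      using suminf_minus_initial_segment[OF s, of n] by (simp add: norm_minus_commute)
    also have "\<dots> \<le> (\<Sum>i. C (i + n))"
      using g sC by (intro norm_suminf_le summable_ignore_initial_segment) auto
    finally show "norm ((\<Sum>i<n. g i) - (\<Sum>i. g i)) \<le> (\<Sum>i. C (i + n))" .
  qed
  define g' where "g' p h = (\<Sum>n. a n p) * fst h + (\<Sum>n. b n p) * snd h" for p h :: "complex \<times> complex"
  have zS: "(0, 0) \<in> S" using R by (simp add: S_def)
  have sf: "summable (\<lambda>n. f n p)" if "p \<in> S" for p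
    by (rule summable_comparison_test'[OF B]) (use bd that ST T_def in auto)
  have "\<exists>g. \<forall>x\<in>S. (\<lambda>n. f n x) sums (g x) \<and> (g has_derivative g' x) (at x within S)"
  proof (rule has_derivative_series)
    show "convex S" by (auto simp: S_def intro: convex_Times)
    show "(f n has_derivative (\<lambda>h. a n x * fst h + b n x * snd h)) (at x within S)" if "x \<in> S" for n x
      using ab that ST by (blast intro: has_derivative_at_withinI)
    show "\<forall>\<^sub>F n in sequentially. \<forall>x\<in>S. \<forall>h. norm ((\<Sum>i<n. a i x * fst h + b i x * snd h) - g' x h) \<le> e * norm h"
      if e: "e > 0" for e
    proof -
      \<comment> \<open>\<open>N\<close> depends on the tail of \<open>C\<close> alone, hence works
        for all points of \<open>S\<close> at once; each of the two partial derivatives gets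
        \<open>e/2\<close>.\<close>
      obtain N where N: "\<And>n. n \<ge> N \<Longrightarrow> norm (\<Sum>i. C (i + n)) < e / 2"
        using suminf_exist_split[OF _ sC, of "e/2"] e by auto
      show ?thesis
        unfolding eventually_sequentially
      proof (intro exI[of _ N] allI impI ballI)
        fix n x and h :: "complex \<times> complex" assume n: "N \<le> n" and x: "x \<in> S"
        define D1 where "D1 = (\<Sum>i<n. a i x) - (\<Sum>i. a i x)"
        define D2 where "D2 = (\<Sum>i<n. b i x) - (\<Sum>i. b i x)"
        have D: "norm D1 \<le> e/2" "norm D2 \<le> e/2"
          using tail[OF a_le[OF x], of n] tail[OF b_le[OF x], of n] N[OF n] by (auto simp: D1_def D2_def)
        have nh: "norm (fst h) \<le> norm h" "norm (snd h) \<le> norm h"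
          by (metis norm_fst_le norm_snd_le prod.collapse)+
        have "(\<Sum>i<n. a i x * fst h + b i x * snd h) - g' x h = D1 * fst h + D2 * snd h"
          by (simp add: g'_def D1_def D2_def sum.distrib sum_distrib_left sum_distrib_right algebra_simps)
        also have "norm \<dots> \<le> norm D1 * norm (fst h) + norm D2 * norm (snd h)"
          by (metis norm_mult norm_triangle_ineq)
        also have "\<dots> \<le> e/2 * norm h + e/2 * norm h"
          using D e nh by (intro add_mono mult_mono) auto
        finally show "norm ((\<Sum>i<n. a i x * fst h + b i x * snd h) - g' x h) \<le> e * norm h" by simp
      qed
    qed
    show "(0, 0) \<in> S" by (fact zS)
    show "(\<lambda>n. f n (0, 0)) sums (\<Sum>n. f n (0, 0))" using sf[OF zS] by (rule summable_sums)
  qed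
  then obtain g where g: "\<And>x. x \<in> S \<Longrightarrow> (\<lambda>n. f n x) sums (g x)"
    "\<And>x. x \<in> S \<Longrightarrow> (g has_derivative g' x) (at x within S)" by blast
  show ?thesis
    unfolding S_def[symmetric]
  proof (rule holomorphic2_onI)
    fix p assume p: "p \<in> S"
    have "((\<lambda>p. \<Sum>n. f n p) has_derivative g' p) (at p within S)"
      by (rule has_derivative_transform[OF p _ g(2)[OF p]]) (rule sums_unique[OF g(1), symmetric], assumption)
    then show "\<exists>a b. ((\<lambda>p. \<Sum>n. f n p) has_derivative (\<lambda>h. a * fst h + b * snd h)) (at p within S)"
      unfolding g'_def by blast
  qed
qed

section \<open>The generating function\<close>

text \<open>At \<open>M = 0\<close> the factors with \<open>c\<close> and \<open>d\<close> telescope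
  to \<open>c / (c + N)\<close> and \<open>d / (d + N)\<close>, while those with \<open>a\<close>
  give \<open>a^2 / N^2\<close> times the squared product. The form is valid from
  \<open>N = 1\<close> on.\<close>

lemma vwp_0_Suc:
  assumes "norm c < 1" "norm d < 1"
  shows "vwp a c d 0 (Suc m) * (c + of_nat (Suc m)) * (d + of_nat (Suc m)) * of_nat (Suc m) ^ 2 =
     c * d * a\<^sup>2 * (\<Prod>n\<in>{0<..<Suc m}. (1 + a / of_nat n)\<^sup>2)"
proof (induction m)
  case 0
  have "{0<..<Suc 0} = {}" by auto
  moreover have "1 + c \<noteq> 0" "1 + d \<noteq> 0" using one_plus_nat_plus_nonzero[of c 0] one_plus_nat_plus_nonzero[of d 0] assms by auto
  ultimately show ?case by (simp add: vwp_def power2_eq_square add.commute)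
next
  case (Suc m)
  define n where "n = (of_nat (Suc m) :: complex)"
  define V where "V = vwp a c d 0 (Suc m)"
  define P where "P = (\<Prod>n\<in>{0<..<Suc m}. (1 + a / of_nat n)\<^sup>2)"
  have nz: "n \<noteq> 0" "1 + n \<noteq> 0" "1 + c + n \<noteq> 0" "1 + d + n \<noteq> 0"
    using one_plus_nat_plus_nonzero[of c "Suc m"] one_plus_nat_plus_nonzero[of d "Suc m"] one_plus_nat_plus_nonzero[of 0 "Suc m"] assms
    unfolding n_def by (simp_all only: of_nat_eq_0_iff) (simp_all add: algebra_simps)
  have IH: "V * (c + n) * (d + n) * n\<^sup>2 = c * d * a\<^sup>2 * P"
    using Suc by (simp only: V_def n_def P_def)
  have S: "vwp a c d 0 (Suc (Suc m)) = V * ((a + n) * (a + n) * (c + n) * (d + n) / ((1 + n) * (1 + n) * (1 + c + n) * (1 + d + n)))"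
    unfolding vwp_Suc[of _ _ _ _ "Suc m"] V_def[symmetric] n_def[symmetric] by simp
  have n1: "of_nat (Suc (Suc m)) = 1 + n" by (simp add: n_def)
  have "{0<..<Suc (Suc m)} = insert (Suc m) {0<..<Suc m}" by auto
  then have P: "(\<Prod>n\<in>{0<..<Suc (Suc m)}. (1 + a / of_nat n)\<^sup>2) = (1 + a / n)\<^sup>2 * P"
    by (simp add: P_def n_def del: of_nat_Suc)
  have "vwp a c d 0 (Suc (Suc m)) * (c + (1 + n)) * (d + (1 + n)) * (1 + n)\<^sup>2 = (V * (c + n) * (d + n)) * (a + n)\<^sup>2"
    unfolding S using nz by (simp add: power2_eq_square add_ac)
  also have "V * (c + n) * (d + n) = c * d * a\<^sup>2 * P / n\<^sup>2"
    using IH nz by (simp add: field_simps)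
  also have "\<dots> * (a + n)\<^sup>2 = c * d * a\<^sup>2 * ((1 + a / n)\<^sup>2 * P)"
    using nz by (simp add: power2_eq_square divide_simps add.commute)
  finally show ?case unfolding P n1 .
qed

text \<open>The well-poised factor is \<open>1 + 2 N / (- 2 X) = - (N - X) / X\<close>; together
  with \<open>a^2 = 4 X^2\<close> and \<open>c d = - (X + Y) (Y - X)\<close> it yields the prefactor
  and the numerator \<open>N - X\<close>.\<close>

lemma vwp_term_eq_W_summand:
  assumes X: "norm X < 1/40" and Y: "norm Y < 1/40" and X0: "X \<noteq> 0"
  shows "vwp_term (- 2 * X) (- X - Y) (Y - X) 0 (Suc m) = X * (X + Y) * (Y - X) * W_summand X Y (Suc m)"
proof -
  define n where "n = (of_nat (Suc m) :: complex)"
  define P where "P = (\<Prod>n\<in>{0<..<Suc m}. (1 - 2 * X / of_nat n)\<^sup>2)"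
  define V where "V = vwp (- 2 * X) (- X - Y) (Y - X) 0 (Suc m)"
  have nm: "norm (- X - Y) < 1" "norm (Y - X) < 1"
    using norm_triangle_ineq4[of "-X" Y] norm_triangle_ineq4[of Y X] X Y by auto
  have nz: "n \<noteq> 0" "n - X - Y \<noteq> 0" "n - X + Y \<noteq> 0"
    using one_plus_nat_plus_nonzero[OF nm(1), of m] one_plus_nat_plus_nonzero[OF nm(2), of m]
    unfolding n_def by (simp_all only: of_nat_eq_0_iff) (simp_all add: algebra_simps)
  have "V * (- X - Y + n) * (Y - X + n) * n\<^sup>2 = (- X - Y) * (Y - X) * (- 2 * X)\<^sup>2 * P"
    using vwp_0_Suc[OF nm, of "- 2 * X" m] by (simp add: V_def P_def n_def del: of_nat_Suc)
  then have V: "V = (- X - Y) * (Y - X) * (- 2 * X)\<^sup>2 * P / ((n - X - Y) * (n - X + Y) * n\<^sup>2)"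
    using nz by (simp add: eq_divide_eq) (simp add: algebra_simps)
  have "vwp_term (- 2 * X) (- X - Y) (Y - X) 0 (Suc m) = V * (1 + 2 * n / (- 2 * X))"
    by (simp add: vwp_term_def V_def n_def)
  also have "1 + 2 * n / (- 2 * X) = - (n - X) / X" using X0 by (simp add: field_simps)
  also have "V * (- (n - X) / X) = 4 * X * (X + Y) * (Y - X) * P * (n - X) / ((n - X - Y) * (n - X + Y) * n\<^sup>2)"
    unfolding V using X0 nz by (simp add: divide_simps) (simp add: power2_eq_square algebra_simps)
  finally have 1: "vwp_term (- 2 * X) (- X - Y) (Y - X) 0 (Suc m) = 
     4 * X * (X + Y) * (Y - X) * P * (n - X) / ((n - X - Y) * (n - X + Y) * n\<^sup>2)" .
  have "(1 - X / n)\<^sup>2 - (Y / n)\<^sup>2 = (n - X - Y) * (n - X + Y) / n\<^sup>2"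
    using nz by (simp add: power2_eq_square field_simps)
  moreover have "1 - X / n = (n - X) / n" using nz by (simp add: field_simps)
  ultimately have "(1 - X / n) / ((1 - X / n)\<^sup>2 - (Y / n)\<^sup>2) / n ^ 3 = (n - X) / ((n - X - Y) * (n - X + Y) * n\<^sup>2)"
    using nz by (simp add: power2_eq_square power3_eq_cube)
  then have "W_summand X Y (Suc m) = 4 * (P * ((n - X) / ((n - X - Y) * (n - X + Y) * n\<^sup>2)))"
    unfolding W_summand_def n_def[symmetric] P_def[symmetric] by (metis times_divide_eq_right)
  then show ?thesis unfolding 1 by simp
qed

lemma has_sum_positive_imp_sums:
  fixes f :: "nat \<Rightarrow> 'a :: {topological_comm_monoid_add, t2_space}"
  assumes "(f has_sum S) {0<..}"
  shows "(\<lambda>n. f (Suc n)) sums S"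
proof -
  have "(f has_sum S) {0<..} \<longleftrightarrow> ((\<lambda>n. f (Suc n)) has_sum S) UNIV"
    by (rule has_sum_reindex_bij_witness[where i = Suc and j = "\<lambda>n. n - 1"]) auto
  then show ?thesis using assms by (simp add: has_sum_imp_sums)
qed

lemma W_reg_sums:
  assumes "norm X \<le> 1/6" "norm Y \<le> 1/6"
  shows "W_term X Y summable_on W_idx" and "(\<lambda>n. W_summand X Y (Suc n)) sums W_reg X Y"
proof -
  obtain S where S: "(W_term X Y has_sum S) W_idx" "(W_summand X Y has_sum S) {0<..}"
    by (rule W_term_has_sum[OF assms])
  show "W_term X Y summable_on W_idx" using S(1) by (rule has_sum_imp_summable)
  show "(\<lambda>n. W_summand X Y (Suc n)) sums W_reg X Y"
    using has_sum_positive_imp_sums[OF S(2)] S(1) by (simp add: W_reg_def infsumI)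
qed

section \<open>Holomorphy of the summands and conclusion\<close>

lemma holomorphic2_on_W_summand:
  "holomorphic2_on (\<lambda>p. W_summand (fst p) (snd p) (Suc n)) (ball 0 (1/4) \<times> ball 0 (1/4))"
proof -
  let ?N = "of_nat (Suc n) :: complex"
  \<comment> \<open>The denominator is written with sums, products and constants only, to match the
    closure rules. It equals \<open>(N - X - Y) (N - X + Y) / N^2\<close>, nonzero since
    \<open>X + Y\<close> and \<open>Y - X\<close> have norm below 1.\<close>
  have nz: "(1 + fst p * (- 1 / ?N)) * (1 + fst p * (- 1 / ?N)) + (- 1) * (snd p * (1 / ?N) * (snd p * (1 / ?N))) \<noteq> 0"
    if p: "p \<in> ball 0 (1/4) \<times> ball 0 (1/4)" for p :: "complex \<times> complex"
  proof
    obtain X Y where XY: "p = (X, Y)" "norm X < 1/4" "norm Y < 1/4" using p by (cases p) auto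
    have nm: "norm (- X - Y) < 1" "norm (Y - X) < 1"
      using norm_triangle_ineq4[of "-X" Y] norm_triangle_ineq4[of Y X] XY by auto
    have f: "?N - X - Y \<noteq> 0" "?N - X + Y \<noteq> 0" "?N \<noteq> 0"
      using one_plus_nat_plus_nonzero[OF nm(1), of n] one_plus_nat_plus_nonzero[OF nm(2), of n]
      by (simp_all only: of_nat_eq_0_iff) (simp_all add: algebra_simps)
    assume "(1 + fst p * (- 1 / ?N)) * (1 + fst p * (- 1 / ?N)) + (- 1) * (snd p * (1 / ?N) * (snd p * (1 / ?N))) = 0"
    note eq0 = this
    have key: "(1 + X * (- 1 / N)) * (1 + X * (- 1 / N)) + (- 1) * (Y * (1 / N) * (Y * (1 / N))) = 
      (N - X - Y) * (N - X + Y) / N\<^sup>2" if "N \<noteq> 0" for N :: complex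
      using that by (simp add: power2_eq_square field_simps)
    have "(?N - X - Y) * (?N - X + Y) / ?N\<^sup>2 = 0"
      using eq0 unfolding XY(1) fst_conv snd_conv key[OF f(3)] .
    then show False using f by (simp del: of_nat_Suc)
  qed
  have "holomorphic2_on (\<lambda>p. 4 * ((\<Prod>n\<in>{0<..<Suc n}. (1 + fst p * (- 2 / of_nat n)) * (1 + fst p * (- 2 / of_nat n))) *
     ((1 + fst p * (- 1 / ?N)) * inverse ((1 + fst p * (- 1 / ?N)) * (1 + fst p * (- 1 / ?N)) + (- 1) * (snd p * (1 / ?N) * (snd p * (1 / ?N))))) * 
     (1 / ?N ^ 3))) (ball 0 (1/4) \<times> ball 0 (1/4))"
    by (intro holomorphic2_on_mult holomorphic2_on_prod holomorphic2_on_add holomorphic2_on_inverse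
         holomorphic2_on_const holomorphic2_on_fst holomorphic2_on_snd nz)
  also have "(\<lambda>p. 4 * ((\<Prod>n\<in>{0<..<Suc n}. (1 + fst p * (- 2 / of_nat n)) * (1 + fst p * (- 2 / of_nat n))) *
     ((1 + fst p * (- 1 / ?N)) * inverse ((1 + fst p * (- 1 / ?N)) * (1 + fst p * (- 1 / ?N)) + (- 1) * (snd p * (1 / ?N) * (snd p * (1 / ?N))))) * 
     (1 / ?N ^ 3))) = (\<lambda>p. W_summand (fst p) (snd p) (Suc n))"
    unfolding W_summand_def power2_eq_square
    by (rule ext) (simp add: divide_inverse mult_ac del: of_nat_Suc)
  finally show ?thesis .
qed

theorem proposition8:
  shows "\<exists>\<delta>>0.
    holomorphic2_on (\<lambda>(X, Y). W_reg X Y) (ball 0 \<delta> \<times> ball 0 \<delta>) \<and>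
    (\<forall>X\<in>ball 0 \<delta>. \<forall>Y\<in>ball 0 \<delta>.
       W_term X Y summable_on W_idx \<and>
       (X * (X + Y) * (Y - X) \<noteq> 0 \<longrightarrow>
          W_cl X Y = V_cl (2 * X) (- X - Y) (Y - X) / (X * (X + Y) * (Y - X))))"
proof (intro exI conjI ballI impI)
  \<comment> \<open>Radius 1/40 keeps \<open>2 X\<close>, \<open>X + Y\<close> and
    \<open>Y - X\<close> below the 1/20 of \<open>small_params\<close>; the doubled radius needed
    for \<open>holomorphic2_on_suminf\<close> is still within 1/6 and 1/4.\<close>
  show "(0::real) < 1/40" by simp
  let ?B = "ball (0::complex) (1/40)"
  have "holomorphic2_on (\<lambda>p. \<Sum>n. W_summand (fst p) (snd p) (Suc n)) (?B \<times> ?B)"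
  proof (rule holomorphic2_on_suminf)
    show "holomorphic2_on (\<lambda>p. W_summand (fst p) (snd p) (Suc n)) (ball 0 (2 * (1/40)) \<times> ball 0 (2 * (1/40)))" for n
      by (rule holomorphic2_on_subset[OF holomorphic2_on_W_summand]) auto
    show "norm (W_summand (fst p) (snd p) (Suc n)) \<le> 8 * (1 / real (Suc n) ^ 2)"
      if "p \<in> ball 0 (2 * (1/40)) \<times> ball 0 (2 * (1/40))" for n p
      by (rule norm_W_summand_le) (use that in auto)
    have "summable (\<lambda>n. 1 / real n ^ 2)"
      using inverse_power_summable[of 2, where 'a = real] by (simp add: field_simps)
    then show "summable (\<lambda>n. 8 * (1 / real (Suc n) ^ 2))"
      by (intro summable_mult) (subst summable_Suc_iff)
  qed simp
  then show "holomorphic2_on (\<lambda>(X, Y). W_reg X Y) (?B \<times> ?B)"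
  proof (rule holomorphic2_on_cong)
    fix p assume "p \<in> ?B \<times> ?B"
    then show "(case p of (X, Y) \<Rightarrow> W_reg X Y) = (\<Sum>n. W_summand (fst p) (snd p) (Suc n))"
      using W_reg_sums(2)[THEN sums_unique, of "fst p" "snd p"] by (auto simp: case_prod_unfold)
  qed
next
  fix X Y :: complex assume "X \<in> ball 0 (1/40)" "Y \<in> ball 0 (1/40)"
  then have X: "norm X < 1/40" and Y: "norm Y < 1/40" by auto
  show "W_term X Y summable_on W_idx" by (rule W_reg_sums) (use X Y in auto)
  assume D0: "X * (X + Y) * (Y - X) \<noteq> 0"
  interpret small_params "- 2 * X" "- X - Y" "Y - X"
    using norm_triangle_ineq4[of "-X" Y] norm_triangle_ineq4[of Y X] X Y D0
    by unfold_locales (auto simp: norm_mult)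
  let ?D = "X * (X + Y) * (Y - X)"
  have X0: "X \<noteq> 0" using D0 by auto
  have "(\<lambda>m. ?D * W_summand X Y (Suc m)) sums (?D * W_reg X Y)"
    by (intro sums_mult W_reg_sums) (use X Y in auto)
  \<comment> \<open>The term at index 0 is 1; divided by \<open>?D\<close> it is the polar part of
    \<open>W_cl\<close>.\<close>
  moreover have "(\<lambda>m. vwp_term (- 2 * X) (- X - Y) (Y - X) 0 (Suc m)) sums (V_cl (2 * X) (- X - Y) (Y - X) - 1)"
    proof (subst sums_Suc_iff)
    have "vwp_term (- 2 * X) (- X - Y) (Y - X) 0 0 = 1" by (simp add: vwp_term_def vwp_def)
    then show "vwp_term (- 2 * X) (- X - Y) (Y - X) 0 sums
        (V_cl (2 * X) (- X - Y) (Y - X) - 1 + vwp_term (- 2 * X) (- X - Y) (Y - X) 0 0)"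
      using vwp_sums by simp
  qed
  then have "(\<lambda>m. ?D * W_summand X Y (Suc m)) sums (V_cl (2 * X) (- X - Y) (Y - X) - 1)"
    by (simp only: vwp_term_eq_W_summand[OF X Y X0])
  ultimately have "?D * W_reg X Y = V_cl (2 * X) (- X - Y) (Y - X) - 1"
    by (rule sums_unique2)
  then have "V_cl (2 * X) (- X - Y) (Y - X) = 1 + ?D * W_reg X Y"
    by (simp add: algebra_simps)
  then show "W_cl X Y = V_cl (2 * X) (- X - Y) (Y - X) / ?D"
    using D0 by (simp add: W_cl_def add_divide_distrib)
qed

end
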